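(* For all integers $k,n \geq 1$ and $\overline{\Delta} \geq 0$, every strongly $k$-arc-connected $n$-vertex directed multigraph $D$ with $\overline{\Delta}(D) \leq \overline{\Delta}$ contains a strongly $k$-arc-connected spanning subgraph with at most $kn + 666k\overline{\Delta} + 666k^2$ edges.
   Context: A directed multigraph is a pair $(V,E)$ with $V$ finite and $E$ a multiset of elements of $(V\times V)\setminus\{(v,v)\}$. $\overline{\Delta}(D)$ is the maximum over $v\in V(D)$ of the number of vertices $w\neq v$ with neither $(v,w)$ nor $(w,v)$ in $E(D)$. A directed multigraph is strongly $k$-arc-connected if deleting any at most $k-1$ edges (counted with multiplicity) leaves it strongly connected. *)

theory Defs
  imports Main "HOL-Library.Multiset"
begin

type_synonym 'a multidigraph = "'a set \<times> ('a \<times> 'a) multiset"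

abbreviation verts :: "'a multidigraph \<Rightarrow> 'a set" where
  "verts D \<equiv> fst D"

abbreviation edges :: "'a multidigraph \<Rightarrow> ('a \<times> 'a) multiset" where
  "edges D \<equiv> snd D"

definition directed_multigraph :: "'a multidigraph \<Rightarrow> bool" where
  "directed_multigraph D \<longleftrightarrow>
     finite (verts D) \<and> set_mset (edges D) \<subseteq> (verts D \<times> verts D) - {(v, v) | v. v \<in> verts D}"

text \<open>Since \<open>Max {}\<close> is unspecified, this is meaningful only for a nonempty vertex set.\<close>

definition max_non_neighbours :: "'a multidigraph \<Rightarrow> nat" where
  "max_non_neighbours D =
     Max ((\<lambda>v. card {w \<in> verts D. w \<noteq> v \<and> (v, w) \<notin># edges D \<and> (w, v) \<notin># edges D}) ` verts D)"

definition strongly_connected :: "'a multidigraph \<Rightarrow> bool" where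
  "strongly_connected D \<longleftrightarrow>
     (\<forall>u \<in> verts D. \<forall>v \<in> verts D. (u, v) \<in> (set_mset (edges D))\<^sup>*)"

text \<open>The bound is written \<open>size F < k\<close> rather than \<open>size F \<le> k - 1\<close> to avoid truncated
  subtraction; the two agree for \<open>k \<ge> 1\<close>. A graph with a single vertex satisfies this for
  every \<open>k\<close>.\<close>

definition strongly_arc_connected :: "nat \<Rightarrow> 'a multidigraph \<Rightarrow> bool" where
  "strongly_arc_connected k D \<longleftrightarrow>
     (\<forall>F. F \<subseteq># edges D \<and> size F < k \<longrightarrow> strongly_connected (verts D, edges D - F))"

definition spanning_subgraph :: "'a multidigraph \<Rightarrow> 'a multidigraph \<Rightarrow> bool" where
  "spanning_subgraph H D \<longleftrightarrow>
     directed_multigraph H \<and> verts H = verts D \<and> edges H \<subseteq># edges D"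

end

theory Submission
  imports Defs
begin

text \<open>
  An edge-minimal subgraph in which every nonempty \<open>X \<subseteq> S\<close> has at least \<open>k\<close> leaving edges has, by
  uncrossing tight sets, at most \<open>k |S|\<close> edges. So a set \<open>S\<close> of \<open>O(k + \<Delta>)\<close> exceptional vertices can be
  served separately, and if \<open>n = O(k + \<Delta>)\<close> one takes \<open>S = V\<close>.

  Let \<open>b\<close> have maximum in-degree and \<open>a\<close> maximum out-degree, and let \<open>P\<close> be an edge-minimal subgraph in
  which every set containing \<open>b\<close> but not \<open>a\<close> is left by \<open>k\<close> edges; \<open>P\<close> behaves like \<open>k\<close> edge-disjoint
  paths from \<open>b\<close> to \<open>a\<close>. For each \<open>j < k\<close>, the non-exceptional vertices \<open>v\<close> with \<open>odeg P v + j < k\<close> are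
  covered by \<open>\<Delta> + 2k + 1\<close> paths, all edge-disjoint from \<open>P\<close> and across different \<open>j\<close>. Together this costs
  at most \<open>kn\<close> edges, and every non-exceptional vertex is left by \<open>k\<close> edge-disjoint tracks. The ends
  of the paths of level \<open>j\<close> are joined by links of length at most three to a hub \<open>h j\<close> of nearly maximum
  in-degree, which has \<open>k\<close> edge-disjoint short paths to \<open>b\<close>. Hence every set avoiding \<open>b\<close> is left by \<open>k\<close>
  edges. By reversal every set containing \<open>a\<close> is left by \<open>k\<close> edges, and \<open>P\<close> accounts for the sets
  containing \<open>b\<close> but not \<open>a\<close>.
\<close>

section \<open>Edge cuts and minimal subgraphs\<close>

text \<open>\<open>X\<close> may be any set of the type and parallel edges count separately. The
  edges entering \<open>X\<close> are counted by \<open>cut_out M (- X)\<close>, so reversal amounts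
  to taking complements.\<close>

definition cut_out :: "('a \<times> 'a) multiset \<Rightarrow> 'a set \<Rightarrow> nat" where
  "cut_out M X = size {#e \<in># M. fst e \<in> X \<and> snd e \<notin> X#}"

definition odeg :: "('a \<times> 'a) multiset \<Rightarrow> 'a \<Rightarrow> nat" where
  "odeg M v = size {#e \<in># M. fst e = v#}"

definition ideg :: "('a \<times> 'a) multiset \<Rightarrow> 'a \<Rightarrow> nat" where
  "ideg M v = size {#e \<in># M. snd e = v#}"

abbreviation rev_edges :: "('a \<times> 'a) multiset \<Rightarrow> ('a \<times> 'a) multiset" where
  "rev_edges \<equiv> image_mset prod.swap"

lemma cut_out_empty [simp]: "cut_out {#} X = 0"
  by (simp add: cut_out_def)

lemma cut_out_add_mset:
  "cut_out (add_mset e M) X = cut_out M X + (if fst e \<in> X \<and> snd e \<notin> X then 1 else 0)"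
  by (simp add: cut_out_def)

lemma odeg_add_mset: "odeg (add_mset e M) v = odeg M v + (if fst e = v then 1 else 0)"
  by (simp add: odeg_def)

lemma ideg_add_mset: "ideg (add_mset e M) v = ideg M v + (if snd e = v then 1 else 0)"
  by (simp add: ideg_def)

lemma cut_out_add: "cut_out (M + N) X = cut_out M X + cut_out N X"
  by (simp add: cut_out_def)

lemma cut_out_mono: "M \<subseteq># N \<Longrightarrow> cut_out M X \<le> cut_out N X"
  by (metis cut_out_add le_add1 subset_mset.le_iff_add)

lemma cut_out_le_size: "cut_out M X \<le> size M"
  by (simp add: cut_out_def size_filter_mset_lesseq)

text \<open>Compared edge by edge: only edges between \<open>A - B\<close> and \<open>B - A\<close>
  are counted more often on the right.\<close>

lemma cut_out_submodular:
  "cut_out M (A \<inter> B) + cut_out M (A \<union> B) \<le> cut_out M A + cut_out M B"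
  by (induction M) (auto simp: cut_out_add_mset)

lemma cut_out_rev: "cut_out (rev_edges M) X = cut_out M (- X)"
  by (induction M) (auto simp: cut_out_add_mset)

lemma odeg_rev: "odeg (rev_edges M) v = ideg M v"
  by (induction M) (auto simp: odeg_def ideg_def)

lemma ideg_rev: "ideg (rev_edges M) v = odeg M v"
  by (induction M) (auto simp: odeg_def ideg_def)

lemma rev_rev_edges [simp]: "rev_edges (rev_edges M) = M"
  by (simp add: image_mset.compositionality)

lemma set_rev_edges: "set_mset (rev_edges M) = (set_mset M)\<inverse>"
  by auto

lemma odeg_le_cut_out:
  assumes "v \<in> X" and "\<And>y. (v, y) \<in># M \<Longrightarrow> y \<notin> X"
  shows "odeg M v \<le> cut_out M X"
proof -
  have "{#e \<in># M. fst e = v#} \<subseteq># {#e \<in># M. fst e \<in> X \<and> snd e \<notin> X#}"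
    using assms by (intro filter_mset_mono_strong) auto
  then show ?thesis
    unfolding odeg_def cut_out_def by (rule size_mset_mono)
qed

lemma size_eq_sum_odeg:
  assumes "finite S" and "fst ` set_mset M \<subseteq> S"
  shows "size M = (\<Sum>v\<in>S. odeg M v)"
  using assms(2)
proof (induction M)
  case empty
  then show ?case by (simp add: odeg_def)
next
  case (add e M)
  then show ?case
    using assms(1) by (simp add: odeg_add_mset sum.distrib)
qed

text \<open>Turns edge deletion into a condition on cuts. A cut with fewer than \<open>k\<close>
  edges may itself be deleted; conversely, after a harmful deletion the set reachable from
  \<open>u\<close> is left only by deleted edges.\<close>

lemma strongly_arc_connected_iff:
  "strongly_arc_connected k D \<longleftrightarrow>
     (\<forall>X. X \<inter> verts D \<noteq> {} \<and> \<not> verts D \<subseteq> X \<longrightarrow> k \<le> cut_out (edges D) X)"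
proof
  assume con: "strongly_arc_connected k D"
  show "\<forall>X. X \<inter> verts D \<noteq> {} \<and> \<not> verts D \<subseteq> X \<longrightarrow> k \<le> cut_out (edges D) X"
  proof (intro allI impI, rule ccontr)
    fix X
    assume X: "X \<inter> verts D \<noteq> {} \<and> \<not> verts D \<subseteq> X" and small: "\<not> k \<le> cut_out (edges D) X"
    define F where "F = {#e \<in># edges D. fst e \<in> X \<and> snd e \<notin> X#}"
    obtain u v where uv: "u \<in> X" "u \<in> verts D" "v \<in> verts D" "v \<notin> X"
      using X by blast
    have "F \<subseteq># edges D" "size F < k"
      using small by (simp_all add: F_def cut_out_def)
    then have "(u, v) \<in> (set_mset (edges D - F))\<^sup>*"
      using con uv unfolding strongly_arc_connected_def strongly_connected_def by simp
    moreover have "edges D - F = {#e \<in># edges D. \<not> (fst e \<in> X \<and> snd e \<notin> X)#}"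
      unfolding F_def by (rule multiset_eqI) auto
    then have "set_mset (edges D - F) \<subseteq> {e. \<not> (fst e \<in> X \<and> snd e \<notin> X)}" by auto
    ultimately have "(u, v) \<in> {e. \<not> (fst e \<in> X \<and> snd e \<notin> X)}\<^sup>*"
      using rtrancl_mono by blast
    then have "v \<in> X"
      by (induction rule: rtrancl_induct) (use uv in auto)
    with uv show False by simp
  qed
next
  assume cut: "\<forall>X. X \<inter> verts D \<noteq> {} \<and> \<not> verts D \<subseteq> X \<longrightarrow> k \<le> cut_out (edges D) X"
  show "strongly_arc_connected k D"
    unfolding strongly_arc_connected_def strongly_connected_def
  proof (intro allI impI ballI, rule ccontr)
    fix F u v
    assume F: "F \<subseteq># edges D \<and> size F < k"
      and u: "u \<in> verts (verts D, edges D - F)" and v: "v \<in> verts (verts D, edges D - F)"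
      and no: "(u, v) \<notin> (set_mset (edges (verts D, edges D - F)))\<^sup>*"
    define X where "X = (set_mset (edges D - F))\<^sup>* `` {u}"
    have "k \<le> cut_out (edges D) X"
      using u v no by (intro cut[rule_format]) (auto simp: X_def)
    moreover have "cut_out (edges D - F) X = 0"
      unfolding cut_out_def size_eq_0_iff_empty filter_mset_eq_mempty_iff X_def
      by (auto intro: rtrancl_into_rtrancl)
    moreover have "cut_out (edges D) X = cut_out F X + cut_out (edges D - F) X"
      using F by (metis cut_out_add subset_mset.add_diff_inverse)
    moreover have "cut_out F X < k"
      using F cut_out_le_size le_less_trans by blast
    ultimately show False by simp
  qed
qed

section \<open>Edge-minimal covers of set families and uncrossing\<close>

text \<open>In a cover of least size, deleting an edge violates some constraint; since one edge
  changes a cut by at most one, that cut has exactly \<open>k\<close> edges.\<close>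

lemma minimal_cut_cover:
  assumes "\<And>X. X \<in> \<F> \<Longrightarrow> k \<le> cut_out E X"
  obtains M where "M \<subseteq># E" "\<And>X. X \<in> \<F> \<Longrightarrow> k \<le> cut_out M X"
    "\<And>e. e \<in># M \<Longrightarrow> \<exists>T\<in>\<F>. fst e \<in> T \<and> snd e \<notin> T \<and> cut_out M T = k"
proof -
  define Q where "Q M \<longleftrightarrow> M \<subseteq># E \<and> (\<forall>X\<in>\<F>. k \<le> cut_out M X)" for M
  have "Q E" using assms by (simp add: Q_def)
  then obtain M where M: "Q M" and min: "\<And>N. Q N \<Longrightarrow> size M \<le> size N"
    using ex_has_least_nat[of Q E size] by blast
  have "\<exists>T\<in>\<F>. fst e \<in> T \<and> snd e \<notin> T \<and> cut_out M T = k" if e: "e \<in># M" for e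
  proof -
    have "size (M - {#e#}) < size M"
      using e by (metis size_Diff1_less)
    then have "\<not> Q (M - {#e#})" using min leD by blast
    moreover have "M - {#e#} \<subseteq># E"
      using M unfolding Q_def by (meson diff_subset_eq_self subset_mset.order_trans)
    ultimately obtain T where T: "T \<in> \<F>" "cut_out (M - {#e#}) T < k"
      unfolding Q_def by (auto simp: not_le)
    have "k \<le> cut_out M T" using M T(1) unfolding Q_def by simp
    moreover have "cut_out M T = cut_out (M - {#e#}) T + (if fst e \<in> T \<and> snd e \<notin> T then 1 else 0)"
      using cut_out_add_mset[of e "M - {#e#}" T] e by simp
    ultimately show ?thesis
      using T by (intro bexI[of _ T]) (auto split: if_splits)
  qed
  with M show thesis by (intro that) (auto simp: Q_def)
qed

text \<open>Uncrossing: the tight sets witnessing the individual out-edges of \<open>v\<close> all contain \<open>v\<close>, so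
  their intersection is again tight.\<close>

lemma common_tight_set:
  assumes cov: "\<And>X. X \<in> \<F> \<Longrightarrow> k \<le> cut_out M X"
    and closed: "\<And>A B. A \<in> \<F> \<Longrightarrow> B \<in> \<F> \<Longrightarrow> A \<inter> B \<noteq> {} \<Longrightarrow> A \<inter> B \<in> \<F> \<and> A \<union> B \<in> \<F>"
    and tight: "\<And>e. e \<in># M \<Longrightarrow> \<exists>T\<in>\<F>. fst e \<in> T \<and> snd e \<notin> T \<and> cut_out M T = k"
    and v: "v \<in> fst ` set_mset M"
  obtains T where "T \<in> \<F>" "v \<in> T" "cut_out M T = k" "\<And>y. (v, y) \<in># M \<Longrightarrow> y \<notin> T"
proof -
  have "\<exists>T\<in>\<F>. v \<in> T \<and> cut_out M T = k \<and> (\<forall>y\<in>Y. y \<notin> T)"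
    if "finite Y" "Y \<noteq> {}" "Y \<subseteq> {y. (v, y) \<in># M}" for Y
    using that
  proof (induction Y rule: finite_ne_induct)
    case (singleton y)
    then show ?case using tight[of "(v, y)"] by auto
  next
    case (insert y Y)
    then obtain A where A: "A \<in> \<F>" "v \<in> A" "cut_out M A = k" "\<forall>y\<in>Y. y \<notin> A" by auto
    obtain B where B: "B \<in> \<F>" "v \<in> B" "cut_out M B = k" "y \<notin> B"
      using tight[of "(v, y)"] insert by auto
    have "A \<inter> B \<in> \<F>" "A \<union> B \<in> \<F>" using closed[of A B] A B by auto
    \<comment> \<open>Both new cuts have at least \<open>k\<close> edges, while submodularity bounds
      their sum by \<open>k + k\<close>.\<close>
    then have "cut_out M (A \<inter> B) = k"
      using cov[of "A \<inter> B"] cov[of "A \<union> B"] cut_out_submodular[of M A B] A B by linarith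
    then show ?case using A B \<open>A \<inter> B \<in> \<F>\<close> by (intro bexI[of _ "A \<inter> B"]) auto
  qed
  moreover have "finite {y. (v, y) \<in># M}"
    by (rule finite_subset[of _ "snd ` set_mset M"]) force+
  moreover have "{y. (v, y) \<in># M} \<noteq> {}" using v by force
  ultimately show thesis using that by blast
qed

text \<open>In a minimal cover all out-edges of \<open>v\<close> leave one tight set, so
  \<open>v\<close> has out-degree at most \<open>k\<close>; and every edge starts in
  \<open>S\<close>, because it leaves a subset of \<open>S\<close>.\<close>

lemma sparse_out_cover:
  assumes "finite S" and "\<And>X. X \<noteq> {} \<Longrightarrow> X \<subseteq> S \<Longrightarrow> k \<le> cut_out E X"
  obtains M where "M \<subseteq># E" "size M \<le> k * card S" "\<And>X. X \<noteq> {} \<Longrightarrow> X \<subseteq> S \<Longrightarrow> k \<le> cut_out M X"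
proof -
  define \<F> where "\<F> = {X. X \<noteq> {} \<and> X \<subseteq> S}"
  obtain M where M: "M \<subseteq># E" "\<And>X. X \<in> \<F> \<Longrightarrow> k \<le> cut_out M X"
    "\<And>e. e \<in># M \<Longrightarrow> \<exists>T\<in>\<F>. fst e \<in> T \<and> snd e \<notin> T \<and> cut_out M T = k"
    using minimal_cut_cover[of \<F> k E] assms by (auto simp: \<F>_def)
  have "odeg M v \<le> k" for v
  proof (cases "v \<in> fst ` set_mset M")
    case True
    have closed: "A \<inter> B \<in> \<F> \<and> A \<union> B \<in> \<F>" if "A \<in> \<F>" "B \<in> \<F>" "A \<inter> B \<noteq> {}" for A B
      using that by (auto simp: \<F>_def)
    obtain T where "v \<in> T" "cut_out M T = k" "\<And>y. (v, y) \<in># M \<Longrightarrow> y \<notin> T"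
      by (rule common_tight_set[of \<F> k M v, OF M(2) closed M(3) True]) blast+
    then show ?thesis using odeg_le_cut_out[of v T M] by simp
  next
    case False
    then have none: "\<forall>e. e \<in># M \<longrightarrow> fst e \<noteq> v" by force
    have "odeg M v = 0" unfolding odeg_def size_eq_0_iff_empty filter_mset_eq_mempty_iff by (rule none)
    then show ?thesis by simp
  qed
  moreover have "fst ` set_mset M \<subseteq> S"
    using M(3) unfolding \<F>_def by blast
  ultimately have "size M \<le> k * card S"
    using size_eq_sum_odeg[OF assms(1)] sum_bounded_above[of S "odeg M" k]
    by (simp add: mult.commute)
  with M show thesis by (intro that) (auto simp: \<F>_def)
qed

lemma sparse_in_cover:
  assumes "finite S" and "\<And>X. X \<noteq> {} \<Longrightarrow> X \<subseteq> S \<Longrightarrow> k \<le> cut_out E (- X)"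
  obtains M where "M \<subseteq># E" "size M \<le> k * card S" "\<And>X. X \<noteq> {} \<Longrightarrow> X \<subseteq> S \<Longrightarrow> k \<le> cut_out M (- X)"
proof -
  obtain M where M: "M \<subseteq># rev_edges E" "size M \<le> k * card S"
    "\<And>X. X \<noteq> {} \<Longrightarrow> X \<subseteq> S \<Longrightarrow> k \<le> cut_out M X"
    using sparse_out_cover[of S k "rev_edges E"] assms by (auto simp: cut_out_rev)
  show thesis
  proof (rule that)
    show "rev_edges M \<subseteq># E"
      using image_mset_subseteq_mono[OF M(1), of prod.swap] by simp
  qed (use M in \<open>auto simp: cut_out_rev\<close>)
qed

section \<open>Edge-minimal flows between two vertices\<close>

text \<open>All out-edges of \<open>v\<close> leave \<open>T\<close> and are lost from the cut when
  \<open>v\<close> is removed, while at most the in-edges of \<open>v\<close> are gained.\<close>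

lemma cut_out_remove_vertex:
  assumes "v \<in> T" and "\<And>y. (v, y) \<in># M \<Longrightarrow> y \<notin> T"
  shows "cut_out M (T - {v}) + odeg M v \<le> cut_out M T + ideg M v"
  using assms(2)
proof (induction M)
  case (add e M)
  have "(fst e = v \<longrightarrow> snd e \<notin> T)" using add.prems[of "snd e"] by auto
  then show ?case
    using add assms(1) by (auto simp: cut_out_add_mset odeg_add_mset ideg_add_mset)
qed (simp add: odeg_def)

text \<open>Everything follows from one tight set \<open>T\<close> left by all out-edges of
  \<open>v\<close>. Uncrossing \<open>T\<close> with \<open>X\<close> gives the second claim; the
  third holds because \<open>T - {v}\<close> still separates \<open>b\<close> from \<open>a\<close>,
  so its cut is no smaller than that of \<open>T\<close>.\<close>

lemma tight_flow_out:
  assumes cov: "\<And>X. b \<in> X \<Longrightarrow> a \<notin> X \<Longrightarrow> k \<le> cut_out P X"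
    and tight: "\<And>e. e \<in># P \<Longrightarrow> \<exists>T. b \<in> T \<and> a \<notin> T \<and> fst e \<in> T \<and> snd e \<notin> T \<and> cut_out P T = k"
  shows "odeg P v \<le> k"
    and "v \<in> X \<Longrightarrow> a \<notin> X \<Longrightarrow> odeg P v \<le> cut_out P X"
    and "v \<noteq> b \<Longrightarrow> odeg P v \<le> ideg P v"
proof -
  have "odeg P v \<le> k \<and> (v \<in> X \<longrightarrow> a \<notin> X \<longrightarrow> odeg P v \<le> cut_out P X) \<and>
    (v \<noteq> b \<longrightarrow> odeg P v \<le> ideg P v)"
  proof (cases "v \<in> fst ` set_mset P")
    case True
    define \<F> where "\<F> = {X. b \<in> X \<and> a \<notin> X}"
    have "\<And>X. X \<in> \<F> \<Longrightarrow> k \<le> cut_out P X" using cov by (simp add: \<F>_def)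
    moreover have "\<And>A B. A \<in> \<F> \<Longrightarrow> B \<in> \<F> \<Longrightarrow> A \<inter> B \<noteq> {} \<Longrightarrow> A \<inter> B \<in> \<F> \<and> A \<union> B \<in> \<F>"
      by (auto simp: \<F>_def)
    moreover have "\<And>e. e \<in># P \<Longrightarrow> \<exists>T\<in>\<F>. fst e \<in> T \<and> snd e \<notin> T \<and> cut_out P T = k"
      using tight unfolding \<F>_def Bex_def mem_Collect_eq conj_assoc by blast
    ultimately obtain T where "T \<in> \<F>" and T': "v \<in> T" "cut_out P T = k" "\<And>y. (v, y) \<in># P \<Longrightarrow> y \<notin> T"
      using True by (rule common_tight_set[of \<F> k P v]) blast+
    then have T: "b \<in> T" "a \<notin> T" "v \<in> T" "cut_out P T = k" "\<And>y. (v, y) \<in># P \<Longrightarrow> y \<notin> T"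
      by (auto simp: \<F>_def)
    have "odeg P v \<le> cut_out P X" if X: "v \<in> X" "a \<notin> X"
    proof -
      have "k \<le> cut_out P (T \<union> X)" using T X by (intro cov) auto
      moreover have "odeg P v \<le> cut_out P (T \<inter> X)" using T X by (intro odeg_le_cut_out) auto
      ultimately show ?thesis using cut_out_submodular[of P T X] T(4) by linarith
    qed
    moreover have "odeg P v \<le> k" using odeg_le_cut_out[of v T P, OF T(3,5)] T(4) by simp
    moreover have "odeg P v \<le> ideg P v" if "v \<noteq> b"
      using cut_out_remove_vertex[of v T P, OF T(3,5)] cov[of "T - {v}"] T that by auto
    ultimately show ?thesis by blast
  next
    case False
    then have none: "\<forall>e. e \<in># P \<longrightarrow> fst e \<noteq> v" by force
    have "odeg P v = 0" unfolding odeg_def size_eq_0_iff_empty filter_mset_eq_mempty_iff by (rule none)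
    then show ?thesis by simp
  qed
  then show "odeg P v \<le> k" "v \<in> X \<Longrightarrow> a \<notin> X \<Longrightarrow> odeg P v \<le> cut_out P X"
    "v \<noteq> b \<Longrightarrow> odeg P v \<le> ideg P v" by auto
qed

text \<open>A substitute for \<open>k\<close> edge-disjoint paths: \<open>tight_flow_out\<close> is
  applied to \<open>P\<close> and, with \<open>a\<close> and \<open>b\<close> exchanged, to its
  reversal. The two degree inequalities combine to conservation at inner vertices.\<close>

lemma minimal_flow:
  assumes "\<And>X. b \<in> X \<Longrightarrow> a \<notin> X \<Longrightarrow> k \<le> cut_out E X"
  obtains P where "P \<subseteq># E" "\<And>X. b \<in> X \<Longrightarrow> a \<notin> X \<Longrightarrow> k \<le> cut_out P X"
    "\<And>v. odeg P v \<le> k" "\<And>v. ideg P v \<le> k"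
    "\<And>v X. v \<in> X \<Longrightarrow> a \<notin> X \<Longrightarrow> odeg P v \<le> cut_out P X"
    "\<And>v X. v \<in> X \<Longrightarrow> b \<notin> X \<Longrightarrow> ideg P v \<le> cut_out P (- X)"
    "\<And>v. v \<noteq> a \<Longrightarrow> v \<noteq> b \<Longrightarrow> odeg P v = ideg P v"
proof -
  obtain P where P: "P \<subseteq># E" "\<And>X. b \<in> X \<Longrightarrow> a \<notin> X \<Longrightarrow> k \<le> cut_out P X"
    "\<And>e. e \<in># P \<Longrightarrow> \<exists>T. b \<in> T \<and> a \<notin> T \<and> fst e \<in> T \<and> snd e \<notin> T \<and> cut_out P T = k"
    using minimal_cut_cover[of "{X. b \<in> X \<and> a \<notin> X}" k E] assms
    unfolding mem_Collect_eq Bex_def conj_assoc by metis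
  note out = tight_flow_out[where b = b and a = a and k = k and P = P, OF P(2,3)]
  have rcov: "k \<le> cut_out (rev_edges P) X" if "a \<in> X" "b \<notin> X" for X
    using P(2)[of "- X"] that by (simp add: cut_out_rev)
  have rtight: "\<exists>T. a \<in> T \<and> b \<notin> T \<and> fst e \<in> T \<and> snd e \<notin> T \<and> cut_out (rev_edges P) T = k"
    if "e \<in># rev_edges P" for e
  proof -
    have "prod.swap e \<in># P" using that by auto
    from P(3)[OF this] obtain T where "b \<in> T" "a \<notin> T" "snd e \<in> T" "fst e \<notin> T" "cut_out P T = k"
      by auto
    then show ?thesis by (intro exI[of _ "- T"]) (auto simp: cut_out_rev)
  qed
  note inn = tight_flow_out[where b = a and a = b and k = k and P = "rev_edges P", OF rcov rtight, unfolded odeg_rev ideg_rev cut_out_rev]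
  show thesis
  proof (rule that[OF P(1,2)])
    show "odeg P v \<le> k" "ideg P v \<le> k" for v
      using out(1) inn(1) by auto
    show "odeg P v \<le> cut_out P X" if "v \<in> X" "a \<notin> X" for v X
      using out(2) that by auto
    show "ideg P v \<le> cut_out P (- X)" if "v \<in> X" "b \<notin> X" for v X
      using inn(2) that by auto
    show "odeg P v = ideg P v" if "v \<noteq> a" "v \<noteq> b" for v
      using out(3)[of v] inn(3)[of v] that by auto
  qed auto
qed

section \<open>Short links in dense digraphs\<close>

text \<open>\<open>E\<close> stands for the set of pairs underlying the multigraph: links and path
  systems take pairs from it without multiplicity.\<close>

locale dense_digraph =
  fixes V :: "'a set" and E :: "('a \<times> 'a) set" and \<Delta> :: nat
  assumes finite_V: "finite V"
    and E_sub: "E \<subseteq> V \<times> V"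
    and loopless: "(v, v) \<notin> E"
    and non_neighbours: "v \<in> V \<Longrightarrow> card {w \<in> V. w \<noteq> v \<and> (v, w) \<notin> E \<and> (w, v) \<notin> E} \<le> \<Delta>"

lemma (in dense_digraph) dense_converse: "dense_digraph V (E\<inverse>) \<Delta>"
proof
  show "card {w \<in> V. w \<noteq> v \<and> (v, w) \<notin> E\<inverse> \<and> (w, v) \<notin> E\<inverse>} \<le> \<Delta>" if "v \<in> V" for v
    using non_neighbours[OF that] by (simp add: conj_commute)
qed (use finite_V E_sub loopless in auto)

context dense_digraph
begin

lemma finite_E: "finite E"
  using finite_subset[OF E_sub] finite_V by simp

lemma finite_out [simp]: "finite (E `` A)"
  using E_sub finite_V by (auto intro: finite_subset[of _ V])

lemma finite_in [simp]: "finite (E\<inverse> `` A)"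
  using E_sub finite_V by (auto intro: finite_subset[of _ V])

text \<open>Averaging inside \<open>U\<close>: in-degrees and out-degrees have the same sum, and
  each vertex has, counting itself, at most \<open>\<Delta> + 1\<close> non-neighbours in
  \<open>U\<close>.\<close>

lemma exists_large_indegree:
  assumes "U \<subseteq> V" and "U \<noteq> {}"
  shows "\<exists>u\<in>U. card U \<le> 2 * card (E\<inverse> `` {u} \<inter> U) + 1 + \<Delta>"
proof (rule ccontr)
  assume "\<not> ?thesis"
  then have small: "2 * card (E\<inverse> `` {u} \<inter> U) + 1 + \<Delta> < card U" if "u \<in> U" for u
    using that by (simp add: not_le)
  have fin: "finite U" using assms finite_V finite_subset by blast
  have swap: "(\<Sum>u\<in>U. card (E\<inverse> `` {u} \<inter> U)) = (\<Sum>u\<in>U. card (E `` {u} \<inter> U))"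
  proof -
    have "(\<Sum>u\<in>U. card (E\<inverse> `` {u} \<inter> U)) = (\<Sum>u\<in>U. \<Sum>w\<in>U. if (w, u) \<in> E then 1 else 0)"
      using fin by (intro sum.cong refl) (simp add: sum.If_cases Int_def conj_commute)
    also have "\<dots> = (\<Sum>w\<in>U. \<Sum>u\<in>U. if (w, u) \<in> E then 1 else 0)"
      by (rule sum.swap)
    also have "\<dots> = (\<Sum>u\<in>U. card (E `` {u} \<inter> U))"
      using fin by (intro sum.cong refl) (simp add: sum.If_cases Int_def conj_commute)
    finally show ?thesis .
  qed
  have "card U \<le> card (E\<inverse> `` {u} \<inter> U) + card (E `` {u} \<inter> U) + 1 + \<Delta>" if "u \<in> U" for u
  proof -
    have "U \<subseteq> (E\<inverse> `` {u} \<inter> U) \<union> (E `` {u} \<inter> U) \<union> {u} \<union>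
        {w \<in> V. w \<noteq> u \<and> (u, w) \<notin> E \<and> (w, u) \<notin> E}" (is "_ \<subseteq> ?A \<union> ?B \<union> {u} \<union> ?C")
      using assms by auto
    then have "card U \<le> card (?A \<union> ?B \<union> {u} \<union> ?C)"
      using finite_V by (intro card_mono) auto
    also have "\<dots> \<le> card ?A + card ?B + card {u} + card ?C"
      by (intro order_trans[OF card_Un_le] add_mono card_Un_le order_refl)
    also have "\<dots> \<le> card ?A + card ?B + 1 + \<Delta>"
      using non_neighbours[of u] that assms by auto
    finally show ?thesis .
  qed
  then have "(\<Sum>u\<in>U. card U) \<le> (\<Sum>u\<in>U. card (E\<inverse> `` {u} \<inter> U) + card (E `` {u} \<inter> U) + 1 + \<Delta>)"
    by (rule sum_mono)
  also have "\<dots> = (\<Sum>u\<in>U. 2 * card (E\<inverse> `` {u} \<inter> U) + 1 + \<Delta>)"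
    using swap by (simp only: sum.distrib mult_2)
  also have "\<dots> < (\<Sum>u\<in>U. card U)"
    using small fin assms(2) by (intro sum_strict_mono) auto
  finally show False by simp
qed

lemma exists_large_outdegree:
  assumes "U \<subseteq> V" and "U \<noteq> {}"
  shows "\<exists>u\<in>U. card U \<le> 2 * card (E `` {u} \<inter> U) + 1 + \<Delta>"
  using dense_digraph.exists_large_indegree[OF dense_converse assms] by simp

text \<open>Otherwise some vertex of the set would have out-degree at least \<open>\<tau>\<close>
  already within the set.\<close>

lemma card_small_outdegree: "card {v \<in> V. card (E `` {v}) < \<tau>} \<le> 2 * \<tau> + \<Delta>"
proof (cases "{v \<in> V. card (E `` {v}) < \<tau>} = {}")
  case False
  then obtain u where u: "u \<in> V" "card (E `` {u}) < \<tau>"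
    "card {v \<in> V. card (E `` {v}) < \<tau>} \<le> 2 * card (E `` {u} \<inter> {v \<in> V. card (E `` {v}) < \<tau>}) + 1 + \<Delta>"
    using exists_large_outdegree[of "{v \<in> V. card (E `` {v}) < \<tau>}"] by blast
  moreover have "card (E `` {u} \<inter> {v \<in> V. card (E `` {v}) < \<tau>}) \<le> card (E `` {u})"
    by (intro card_mono) auto
  ultimately show ?thesis by linarith
next
  case True
  show ?thesis unfolding True by simp
qed

text \<open>If most vertices of \<open>U = N\<^sup>+(e)\<close> avoid \<open>W = N\<^sup>-(t)\<close>, then some \<open>u \<in> U\<close> has many in-neighbours
  inside \<open>U - W\<close>; as its in-degree does not exceed \<open>|W|\<close>, it misses, hence dominates, many vertices
  of \<open>W\<close>.\<close>

lemma short_link: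
  assumes "e \<in> V" "t \<in> V"
    and deg: "\<And>u. u \<in> V \<Longrightarrow> u \<notin> B \<Longrightarrow> card (E\<inverse> `` {u}) \<le> card (E\<inverse> `` {t})"
    and fin: "finite B" "finite C" "finite F"
    and f: "\<And>u. u \<in> V \<Longrightarrow> u \<notin> B \<Longrightarrow> card (F `` {u}) \<le> f"
    and fe: "card (F `` {e}) \<le> fe" and ft: "card (F\<inverse> `` {t}) \<le> ft"
    and large: "fe + card B + ft + 3 * \<Delta> + 2 * (f + ft + card C) + 3 \<le> card (E `` {e})"
  shows "\<exists>u. u \<notin> B \<and> (e, u) \<in> E - F \<and>
    ((u, t) \<in> E - F \<or> (\<exists>w. w \<notin> C \<and> (u, w) \<in> E - F \<and> (w, t) \<in> E - F))"
proof (rule ccontr)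
  assume no: "\<not> ?thesis"
  define W where "W = E\<inverse> `` {t}"
  define U where "U = E `` {e} - F `` {e} - B"
  have finF: "finite (F `` A)" "finite (F\<inverse> `` A)" for A
    using fin(3) by auto
  have finW: "finite W" by (simp add: W_def)
  have finU: "finite U" by (simp add: U_def)
  have UV: "U \<subseteq> V" using E_sub by (auto simp: U_def)
  have "card (E `` {e}) \<le> card (U \<union> F `` {e} \<union> B)"
    using finU finF fin by (intro card_mono) (auto simp: U_def)
  also have "\<dots> \<le> card U + card (F `` {e}) + card B"
    by (intro order_trans[OF card_Un_le] add_mono card_Un_le order_refl)
  finally have U1: "card (E `` {e}) \<le> card U + fe + card B" using fe by simp
  \<comment> \<open>A vertex \<open>u\<close> in both sets would give the link \<open>e\<close>,
    \<open>u\<close>, \<open>t\<close> unless its last edge is blocked.\<close>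
  have "U \<inter> W \<subseteq> F\<inverse> `` {t}"
    using no unfolding U_def W_def by blast
  then have "card (U \<inter> W) \<le> ft"
    using ft card_mono[OF finF(2)] order_trans by blast
  moreover have "card U = card (U \<inter> W) + card (U - W)"
    using finU by (metis card_Int_Diff)
  ultimately have U2: "3 * \<Delta> + 2 * (f + ft + card C) + 3 \<le> card (U - W)"
    using U1 large by linarith
  then obtain u where u: "u \<in> U - W" "card (U - W) \<le> 2 * card (E\<inverse> `` {u} \<inter> (U - W)) + 1 + \<Delta>"
    using exists_large_indegree[of "U - W"] UV by fastforce
  have uV: "u \<in> V" "u \<notin> B" using u UV by (auto simp: U_def)
  \<comment> \<open>The in-neighbours of \<open>u\<close> in \<open>W\<close> are counted on both
    sides and cancel. The other vertices of \<open>W\<close> are non-neighbours of \<open>u\<close>,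
    or out-neighbours through which the link is blocked by \<open>F\<close> or
    \<open>C\<close>.\<close>
  have "card (E\<inverse> `` {u} \<inter> (U - W)) + card (E\<inverse> `` {u} \<inter> W) =
      card ((E\<inverse> `` {u} \<inter> (U - W)) \<union> (E\<inverse> `` {u} \<inter> W))"
    by (intro card_Un_disjoint[symmetric]) auto
  also have "\<dots> \<le> card (E\<inverse> `` {u})"
    by (intro card_mono) auto
  also have "\<dots> \<le> card W" using deg uV by (simp add: W_def)
  also have "\<dots> \<le> card ((E\<inverse> `` {u} \<inter> W) \<union> {w \<in> V. w \<noteq> u \<and> (u, w) \<notin> E \<and> (w, u) \<notin> E}
      \<union> F `` {u} \<union> F\<inverse> `` {t} \<union> C)" (is "_ \<le> card (?A \<union> ?N \<union> _ \<union> _ \<union> _)")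
  proof (intro card_mono)
    show "finite (?A \<union> ?N \<union> F `` {u} \<union> F\<inverse> `` {t} \<union> C)"
      using finW finF fin finite_V by simp
    show "W \<subseteq> ?A \<union> ?N \<union> F `` {u} \<union> F\<inverse> `` {t} \<union> C"
    proof
      fix w assume w: "w \<in> W"
      have "w \<in> V" "w \<noteq> u" using w u E_sub by (auto simp: W_def)
      moreover have "w \<in> C \<or> (u, w) \<notin> E \<or> (u, w) \<in> F \<or> (w, t) \<in> F"
        using no u w uV unfolding W_def U_def by blast
      ultimately show "w \<in> ?A \<union> ?N \<union> F `` {u} \<union> F\<inverse> `` {t} \<union> C"
        using w by auto
    qed
  qed
  also have "\<dots> \<le> card ?A + card ?N + card (F `` {u}) + card (F\<inverse> `` {t}) + card C"
    by (intro order_trans[OF card_Un_le] add_mono card_Un_le order_refl)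
  finally have "card (E\<inverse> `` {u} \<inter> (U - W)) \<le> \<Delta> + f + ft + card C"
    using non_neighbours[OF uV(1)] f[OF uV] ft by linarith
  then have "2 * card (E\<inverse> `` {u} \<inter> (U - W)) + 1 + \<Delta> \<le> 2 * (\<Delta> + f + ft + card C) + 1 + \<Delta>"
    by simp
  with u(2) have "card (U - W) \<le> 2 * (\<Delta> + f + ft + card C) + 1 + \<Delta>"
    by (rule order_trans)
  with U2 show False by simp
qed

text \<open>The set \<open>Q\<close> consists of the edges of \<open>k\<close> edge-disjoint paths of length at most three.\<close>

lemma robust_link:
  assumes "e \<in> V" "t \<in> V"
    and deg: "\<And>u. u \<in> V \<Longrightarrow> card (E\<inverse> `` {u}) \<le> card (E\<inverse> `` {t})"
    and large: "18 * k + 3 * \<Delta> \<le> card (E `` {e})"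
  shows "\<exists>Q\<subseteq>E. card Q \<le> 3 * k \<and>
    (\<forall>X. e \<in> X \<longrightarrow> t \<notin> X \<longrightarrow> k \<le> card {p \<in> Q. fst p \<in> X \<and> snd p \<notin> X})"
  using large
proof (induction k)
  case 0
  show ?case by (intro exI[of _ "{}"]) auto
next
  case (Suc k)
  then obtain Q where Q: "Q \<subseteq> E" "card Q \<le> 3 * k"
    "\<And>X. e \<in> X \<Longrightarrow> t \<notin> X \<Longrightarrow> k \<le> card {p \<in> Q. fst p \<in> X \<and> snd p \<notin> X}" by auto
  have finQ: "finite Q" using Q(1) finite_E finite_subset by blast
  have out: "card (Q `` {x}) \<le> 3 * k" for x
  proof -
    have "card (Q `` {x}) \<le> card (snd ` Q)"
      using finQ by (intro card_mono) force+
    also have "\<dots> \<le> card Q" using finQ by (rule card_image_le)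
    finally show ?thesis using Q(2) by simp
  qed
  have "card (Q\<inverse> `` {t}) \<le> card (fst ` Q)"
    using finQ by (intro card_mono) force+
  also have "\<dots> \<le> card Q" using finQ by (rule card_image_le)
  finally have inn: "card (Q\<inverse> `` {t}) \<le> 3 * k" using Q(2) by simp
  \<comment> \<open>All edges of \<open>Q\<close> are forbidden and each bound is
    \<open>3 * k\<close>, so \<open>short_link\<close> asks for degree
    \<open>18 * k + 3 * \<Delta> + 3\<close>; this fixes the coefficient 18.\<close>
  have "\<exists>u. u \<notin> {} \<and> (e, u) \<in> E - Q \<and>
      ((u, t) \<in> E - Q \<or> (\<exists>w. w \<notin> {} \<and> (u, w) \<in> E - Q \<and> (w, t) \<in> E - Q))"
    using out inn finQ Suc.prems deg assms(1,2)
    by (intro short_link[where f = "3 * k" and fe = "3 * k" and ft = "3 * k"]) auto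
  then obtain R where R: "finite R" "card R \<le> 3" "R \<subseteq> E - Q"
    and leave: "\<And>X. e \<in> X \<Longrightarrow> t \<notin> X \<Longrightarrow> \<exists>p\<in>R. fst p \<in> X \<and> snd p \<notin> X"
  proof (elim exE conjE disjE)
    fix u assume "(e, u) \<in> E - Q" "(u, t) \<in> E - Q"
    then show thesis
      by (intro that[of "{(e, u), (u, t)}"]) (auto simp: card_insert_if)
  next
    fix u w assume "(e, u) \<in> E - Q" "(u, w) \<in> E - Q" "(w, t) \<in> E - Q"
    then show thesis
      by (intro that[of "{(e, u), (u, w), (w, t)}"]) (auto simp: card_insert_if)
  qed
  show ?case
  proof (intro exI[of _ "Q \<union> R"] conjI allI impI)
    show "Q \<union> R \<subseteq> E" using Q R by auto
    show "card (Q \<union> R) \<le> 3 * Suc k" using card_Un_le[of Q R] Q R by simp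
    fix X assume X: "e \<in> X" "t \<notin> X"
    have "1 \<le> card {p \<in> R. fst p \<in> X \<and> snd p \<notin> X}"
      using leave[OF X] R(1) unfolding One_nat_def Suc_le_eq card_gt_0_iff by force
    then have "Suc k \<le> card {p \<in> Q. fst p \<in> X \<and> snd p \<notin> X} + card {p \<in> R. fst p \<in> X \<and> snd p \<notin> X}"
      using Q(3)[OF X] by linarith
    also have "\<dots> = card ({p \<in> Q. fst p \<in> X \<and> snd p \<notin> X} \<union> {p \<in> R. fst p \<in> X \<and> snd p \<notin> X})"
      using R finQ by (intro card_Un_disjoint[symmetric]) auto
    also have "\<dots> = card {p \<in> Q \<union> R. fst p \<in> X \<and> snd p \<notin> X}"
      by (rule arg_cong[of _ _ card]) auto
    finally show "Suc k \<le> card {p \<in> Q \<union> R. fst p \<in> X \<and> snd p \<notin> X}" .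
  qed
qed

end

section \<open>Path covers\<close>

text \<open>As in Redei's theorem on tournaments, \<open>v\<close> goes directly before the first
  \<open>x\<close> with \<open>(v, x) \<in> A\<close>, or at the end. The clause on
  \<open>hd ys\<close> lets the induction attach the preceding vertex.\<close>

lemma insert_into_path:
  assumes "successively (\<lambda>x y. (x, y) \<in> A) xs" "distinct xs" "v \<notin> set xs"
    and "\<And>x. x \<in> set xs \<Longrightarrow> (v, x) \<in> A \<or> (x, v) \<in> A"
  shows "\<exists>ys. set ys = insert v (set xs) \<and> distinct ys \<and> successively (\<lambda>x y. (x, y) \<in> A) ys \<and>
    (hd ys = v \<or> xs \<noteq> [] \<and> hd ys = hd xs)"
  using assms
proof (induction xs)
  case Nil
  show ?case by (intro exI[of _ "[v]"]) simp
next
  case (Cons x xs)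
  show ?case
  proof (cases "(v, x) \<in> A")
    case True
    with Cons.prems show ?thesis by (intro exI[of _ "v # x # xs"]) simp
  next
    case False
    with Cons.prems(4)[of x] have xv: "(x, v) \<in> A" by simp
    have "successively (\<lambda>x y. (x, y) \<in> A) xs"
      using Cons.prems(1) by (auto simp: successively_Cons)
    with Cons obtain ys where ys: "set ys = insert v (set xs)" "distinct ys"
      "successively (\<lambda>x y. (x, y) \<in> A) ys" "hd ys = v \<or> xs \<noteq> [] \<and> hd ys = hd xs"
      by auto
    then have "(x, hd ys) \<in> A"
      using xv Cons.prems(1) by (auto simp: successively_Cons)
    with ys Cons.prems show ?thesis
      by (intro exI[of _ "x # ys"]) (auto simp: successively_Cons)
  qed
qed

text \<open>The complement of the adjacency graph has maximum degree \<open>d\<close>, so it is greedily coloured with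
  \<open>d + 1\<close> colours; each colour class is semicomplete and hence spanned by a path.\<close>

lemma path_partition:
  assumes "finite U" and "\<And>v. v \<in> U \<Longrightarrow> card {w \<in> U. w \<noteq> v \<and> (v, w) \<notin> A \<and> (w, v) \<notin> A} \<le> d"
  shows "\<exists>p. (\<Union>i\<le>d. set (p i)) = U \<and>
    (\<forall>i. distinct (p i) \<and> successively (\<lambda>x y. (x, y) \<in> A) (p i)) \<and>
    (\<forall>i\<le>d. \<forall>j\<le>d. i \<noteq> j \<longrightarrow> set (p i) \<inter> set (p j) = {})"
  using assms
proof (induction U rule: finite_induct)
  case empty
  show ?case by (intro exI[of _ "\<lambda>_. []"]) simp
next
  case (insert v U)
  define N where "N = {w \<in> insert v U. w \<noteq> v \<and> (v, w) \<notin> A \<and> (w, v) \<notin> A}"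
  have N: "finite N" "card N \<le> d" using insert by (auto simp: N_def)
  have "card {w \<in> U. w \<noteq> u \<and> (u, w) \<notin> A \<and> (w, u) \<notin> A} \<le> d" if "u \<in> U" for u
    using insert.hyps insert.prems[of u] that
    by (intro order_trans[OF card_mono insert.prems[of u]]) auto
  with insert.IH obtain p where p: "(\<Union>i\<le>d. set (p i)) = U"
    "\<And>i. distinct (p i)" "\<And>i. successively (\<lambda>x y. (x, y) \<in> A) (p i)"
    "\<And>i j. i \<le> d \<Longrightarrow> j \<le> d \<Longrightarrow> i \<noteq> j \<Longrightarrow> set (p i) \<inter> set (p j) = {}" by auto
  \<comment> \<open>At most \<open>d\<close> of the \<open>d + 1\<close> disjoint paths can meet the
    set \<open>N\<close> of non-neighbours.\<close>
  obtain i where i: "i \<le> d" "set (p i) \<inter> N = {}"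
  proof (rule ccontr)
    assume "\<not> thesis"
    then have "\<forall>i\<in>{..d}. \<exists>w. w \<in> set (p i) \<inter> N" using that by auto
    then obtain f where f: "\<And>i. i \<le> d \<Longrightarrow> f i \<in> set (p i) \<inter> N"
      by (metis atMost_iff)
    have "inj_on f {..d}" using f p(4) by (fastforce simp: inj_on_def)
    then have "card {..d} \<le> card N" using f N by (intro card_inj_on_le[of f]) auto
    then show False using N by simp
  qed
  have "v \<notin> set (p i)" using insert.hyps i p(1) by auto
  moreover have "(v, x) \<in> A \<or> (x, v) \<in> A" if "x \<in> set (p i)" for x
    using that i p(1) insert.hyps unfolding N_def by auto
  ultimately obtain ys where ys: "set ys = insert v (set (p i))" "distinct ys"
      "successively (\<lambda>x y. (x, y) \<in> A) ys"
    using insert_into_path[OF p(3,2)[of i]] by blast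
  show ?case
  proof (intro exI[of _ "p(i := ys)"] conjI allI impI)
    have "(\<Union>l\<le>d. set ((p(i := ys)) l)) = insert v (\<Union>l\<le>d. set (p l))"
      using i ys(1) by (auto split: if_splits)
    then show "(\<Union>l\<le>d. set ((p(i := ys)) l)) = insert v U" using p(1) by simp
    fix l m assume "l \<le> d" "m \<le> d" "l \<noteq> m"
    then show "set ((p(i := ys)) l) \<inter> set ((p(i := ys)) m) = {}"
      using p(1) p(4)[of l m] ys(1) insert.hyps i by auto
  qed (use p ys in auto)
qed

text \<open>Vertex-disjoint paths recorded by their edges \<open>T\<close>: single-valuedness in
  both directions bounds the degrees by one, and \<open>Ss\<close> and \<open>Es\<close> play the
  part of the first and last vertices.\<close>

definition path_system ::
    "('a \<times> 'a) set \<Rightarrow> 'a set \<Rightarrow> nat \<Rightarrow> 'a set \<Rightarrow> 'a set \<Rightarrow> bool" where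
  "path_system T U r Ss Es \<longleftrightarrow> T \<subseteq> U \<times> U \<and> single_valued T \<and> single_valued (T\<inverse>) \<and>
     Ss \<subseteq> U \<and> Es \<subseteq> U \<and> card Ss \<le> r \<and> card Es \<le> r \<and>
     (\<forall>v\<in>U. (\<exists>s\<in>Ss. (s, v) \<in> T\<^sup>*) \<and> (\<exists>e\<in>Es. (v, e) \<in> T\<^sup>*))"

lemma path_system_converse: "path_system T U r Ss Es \<Longrightarrow> path_system (T\<inverse>) U r Es Ss"
  by (auto simp: path_system_def rtrancl_converse)

text \<open>Each vertex is the tail of at most one edge.\<close>

lemma path_system_card:
  assumes "path_system T U r Ss Es" "finite U"
  shows "card T \<le> card U"
proof -
  have "inj_on fst T" using assms(1) by (auto simp: path_system_def inj_on_def single_valued_def)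
  moreover have "fst ` T \<subseteq> U" using assms(1) by (auto simp: path_system_def)
  ultimately show ?thesis using card_inj_on_le assms(2) by blast
qed

lemma rtrancl_nth:
  assumes "\<And>m. Suc m < length xs \<Longrightarrow> (xs ! m, xs ! Suc m) \<in> T" "m \<le> l" "l < length xs"
  shows "(xs ! m, xs ! l) \<in> T\<^sup>*"
  using assms(2,3)
proof (induction l rule: dec_induct)
  case (step l)
  then show ?case using assms(1)[of l] by (auto intro: rtrancl_into_rtrancl)
qed simp

lemma path_system_exists:
  assumes "finite U" and "\<And>v. v \<in> U \<Longrightarrow> card {w \<in> U. w \<noteq> v \<and> (v, w) \<notin> A \<and> (w, v) \<notin> A} \<le> d"
  shows "\<exists>T Ss Es. T \<subseteq> A \<and> path_system T U (Suc d) Ss Es"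
proof -
  obtain p where p: "(\<Union>i\<le>d. set (p i)) = U"
    "\<And>i. distinct (p i)" "\<And>i. successively (\<lambda>x y. (x, y) \<in> A) (p i)"
    "\<And>i j. i \<le> d \<Longrightarrow> j \<le> d \<Longrightarrow> i \<noteq> j \<Longrightarrow> set (p i) \<inter> set (p j) = {}"
    using path_partition[OF assms] by auto
  define T where "T = {(p i ! m, p i ! Suc m) | i m. i \<le> d \<and> Suc m < length (p i)}"
  \<comment> \<open>Empty lists are left out, because \<open>hd\<close> and \<open>last\<close> are
    arbitrary on them.\<close>
  define I where "I = {i. i \<le> d \<and> p i \<noteq> []}"
  define Es where "Es = (\<lambda>i. last (p i)) ` I"
  define Ss where "Ss = (\<lambda>i. hd (p i)) ` I"
  \<comment> \<open>A vertex determines its path and its position there, which makes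
    \<open>T\<close> and its converse single-valued.\<close>
  have same: "i = j \<and> m = l"
    if "i \<le> d" "j \<le> d" "m < length (p i)" "l < length (p j)" "p i ! m = p j ! l" for i j m l
  proof -
    have "p i ! m \<in> set (p i) \<inter> set (p j)" using that by (metis IntI nth_mem)
    then have "i = j" using p(4) that by blast
    with that show ?thesis using p(2) nth_eq_iff_index_eq by blast
  qed
  have "I \<subseteq> {..d}" "finite I" by (auto simp: I_def intro: finite_subset[of _ "{..d}"])
  then have "card I \<le> Suc d" by (metis card_atMost card_mono finite_atMost)
  then have cards: "card Es \<le> Suc d" "card Ss \<le> Suc d"
    unfolding Es_def Ss_def using card_image_le[OF \<open>finite I\<close>] order_trans by blast+
  have inU: "p i ! m \<in> U" if "i \<le> d" "m < length (p i)" for i m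
    using that p(1) by fastforce
  show ?thesis
  proof (intro exI conjI)
    show "T \<subseteq> A" using p(3) by (auto simp: T_def successively_conv_nth)
    show "path_system T U (Suc d) Ss Es"
      unfolding path_system_def
    proof (intro conjI ballI cards)
      show "T \<subseteq> U \<times> U" using inU by (auto simp: T_def)
      show "single_valued T"
        unfolding single_valued_def T_def using same by (clarsimp) (metis Suc_lessD)
      show "single_valued (T\<inverse>)"
        unfolding single_valued_def T_def using same by (clarsimp) (metis Suc_inject)
      show "Ss \<subseteq> U" "Es \<subseteq> U" using p(1) by (auto simp: Ss_def Es_def I_def)
      fix v assume "v \<in> U"
      then obtain i m where i: "i \<le> d" "m < length (p i)" "v = p i ! m"
        using p(1) by (metis (no_types, lifting) UN_iff atMost_iff in_set_conv_nth)
      have step: "(p i ! l, p i ! Suc l) \<in> T" if "Suc l < length (p i)" for l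
        using that i unfolding T_def by blast
      have "p i \<noteq> []" using i by auto
      then have I: "i \<in> I" and ends: "hd (p i) = p i ! 0" "last (p i) = p i ! (length (p i) - 1)"
        using i by (auto simp: I_def hd_conv_nth last_conv_nth)
      have "(hd (p i), v) \<in> T\<^sup>*" "(v, last (p i)) \<in> T\<^sup>*"
        using rtrancl_nth[of "p i" T 0 m, OF step] rtrancl_nth[of "p i" T m "length (p i) - 1", OF step]
          i unfolding ends by auto
      with I show "\<exists>s\<in>Ss. (s, v) \<in> T\<^sup>*" "\<exists>e\<in>Es. (v, e) \<in> T\<^sup>*"
        unfolding Ss_def Es_def by blast+
    qed
  qed
qed

section \<open>Counting tools for the greedy choices\<close>

lemma card_Image_UN_single_valued:
  assumes "\<And>j. j < (m::nat) \<Longrightarrow> single_valued (T j)"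
  shows "finite ((\<Union>j<m. T j) `` {v})" "card ((\<Union>j<m. T j) `` {v}) \<le> m"
proof -
  have "finite ((\<Union>j<m. T j) `` {v}) \<and> card ((\<Union>j<m. T j) `` {v}) \<le> m"
    using assms
  proof (induction m)
    case (Suc m)
    \<comment> \<open>If \<open>v\<close> has no image under \<open>T m\<close>, the chosen value is
      arbitrary and the inclusion is trivial.\<close>
    have "T m `` {v} \<subseteq> {SOME y. (v, y) \<in> T m}"
      using Suc.prems[of m] unfolding single_valued_def by (auto intro: someI2)
    then obtain y where "T m `` {v} \<subseteq> {y}" ..
    then have one: "finite (T m `` {v})" "card (T m `` {v}) \<le> 1"
      using card_mono[of "{y}"] finite_subset by auto
    have eq: "(\<Union>j<Suc m. T j) `` {v} = (\<Union>j<m. T j) `` {v} \<union> T m `` {v}"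
      by (auto simp: less_Suc_eq)
    then show ?case
      using Suc one card_Un_le[of "(\<Union>j<m. T j) `` {v}" "T m `` {v}"] by auto
  qed simp
  then show "finite ((\<Union>j<m. T j) `` {v})" "card ((\<Union>j<m. T j) `` {v}) \<le> m" by auto
qed

text \<open>Double counting of \<open>M\<close> by first components. It later bounds the number of
  vertices that have used up their middle edges.\<close>

lemma card_overused:
  assumes "finite M" and "(k::nat) \<ge> 1"
  shows "finite {u. k \<le> card (M `` {u})}" "card {u. k \<le> card (M `` {u})} * k \<le> card M"
proof -
  have fin: "finite (M `` {u})" for u using assms(1) by auto
  have "{u. k \<le> card (M `` {u})} \<subseteq> fst ` M"
  proof
    fix u assume "u \<in> {u. k \<le> card (M `` {u})}"
    then have "M `` {u} \<noteq> {}" using assms(2) by force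
    then show "u \<in> fst ` M" by force
  qed
  then show fO: "finite {u. k \<le> card (M `` {u})}" using assms(1) finite_subset by blast
  have "card {u. k \<le> card (M `` {u})} * k \<le> (\<Sum>u\<in>{u. k \<le> card (M `` {u})}. card (M `` {u}))"
    using sum_bounded_below[of "{u. k \<le> card (M `` {u})}" k] by auto
  also have "\<dots> = card (SIGMA u:{u. k \<le> card (M `` {u})}. M `` {u})"
    using fO fin by (simp add: card_SigmaI)
  also have "\<dots> \<le> card M"
    using assms(1) by (intro card_mono) auto
  finally show "card {u. k \<le> card (M `` {u})} * k \<le> card M" .
qed

lemma top_elements:
  fixes f :: "'a \<Rightarrow> nat"
  assumes "finite A" "k \<le> card A"
  shows "\<exists>B\<subseteq>A. card B = k \<and> (\<forall>b\<in>B. \<forall>a\<in>A - B. f a \<le> f b)"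
  using assms(2)
proof (induction k)
  case 0
  show ?case by (intro exI[of _ "{}"]) auto
next
  case (Suc k)
  then obtain B where B: "B \<subseteq> A" "card B = k" "\<forall>b\<in>B. \<forall>a\<in>A - B. f a \<le> f b" by auto
  have fB: "finite B" using B assms(1) finite_subset by blast
  have "A - B \<noteq> {}" using Suc.prems B fB card_mono[of B A] by fastforce
  then obtain c where c: "c \<in> A - B" "\<forall>a\<in>A - B. f a \<le> f c"
    using Max_in[of "f ` (A - B)"] Max_ge[of "f ` (A - B)"] assms(1)
    by (metis (no_types, lifting) empty_is_image finite_Diff finite_imageI imageE imageI)
  then show ?case using B fB by (intro exI[of _ "insert c B"]) auto
qed

section \<open>Edge-disjoint path systems and links\<close>

context dense_digraph
begin

text \<open>The levels are covered one after another. A vertex \<open>v\<close> of level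
  \<open>m\<close> has lost at most \<open>t v + m < k\<close> edges in each direction to
  \<open>\<beta>\<close> and the earlier levels, so it has at most \<open>\<Delta> + 2 * k\<close>
  non-neighbours and \<open>path_system_exists\<close> applies.\<close>

lemma disjoint_path_systems:
  assumes "finite \<beta>"
    and \<beta>: "\<And>v. v \<in> V - S \<Longrightarrow> card (\<beta> `` {v}) \<le> t v \<and> card (\<beta>\<inverse> `` {v}) \<le> t v"
    and "m \<le> k"
  shows "\<exists>T Ss Es. (\<forall>j<m. T j \<subseteq> E - \<beta> \<and>
      path_system (T j) {v \<in> V - S. t v + j < k} (\<Delta> + 2 * k + 1) (Ss j) (Es j)) \<and>
    (\<forall>i<m. \<forall>j<m. i \<noteq> j \<longrightarrow> T i \<inter> T j = {})"
  using assms(3)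
proof (induction m)
  case (Suc m)
  have "m \<le> k" using Suc.prems by simp
  from Suc.IH[OF this] obtain T Ss Es where IH: "\<forall>j<m. T j \<subseteq> E - \<beta> \<and>
      path_system (T j) {v \<in> V - S. t v + j < k} (\<Delta> + 2 * k + 1) (Ss j) (Es j)"
    "\<forall>i<m. \<forall>j<m. i \<noteq> j \<longrightarrow> T i \<inter> T j = {}"
    by (elim exE conjE that)
  then have T: "\<And>j. j < m \<Longrightarrow> T j \<subseteq> E - \<beta>"
    "\<And>j. j < m \<Longrightarrow> path_system (T j) {v \<in> V - S. t v + j < k} (\<Delta> + 2 * k + 1) (Ss j) (Es j)"
    "\<And>i j. i < m \<Longrightarrow> j < m \<Longrightarrow> i \<noteq> j \<Longrightarrow> T i \<inter> T j = {}" by blast+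
  define U where "U = {v \<in> V - S. t v + m < k}"
  define Z where "Z = (\<Union>j<m. T j)"
  have sv: "single_valued (T j)" "single_valued ((T j)\<inverse>)" if "j < m" for j
    using T(2)[OF that] by (auto simp: path_system_def)
  have Zinv: "Z\<inverse> = (\<Union>j<m. (T j)\<inverse>)" by (auto simp: Z_def)
  have Z: "finite (Z `` {v})" "card (Z `` {v}) \<le> m" "finite (Z\<inverse> `` {v})" "card (Z\<inverse> `` {v}) \<le> m" for v
    using card_Image_UN_single_valued[of m T v] card_Image_UN_single_valued[of m "\<lambda>j. (T j)\<inverse>" v] sv
    unfolding Zinv by (auto simp: Z_def)
  have "card {w \<in> U. w \<noteq> v \<and> (v, w) \<notin> E - \<beta> - Z \<and> (w, v) \<notin> E - \<beta> - Z} \<le> \<Delta> + 2 * k"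
    if v: "v \<in> U" for v
  proof -
    let ?N = "{w \<in> V. w \<noteq> v \<and> (v, w) \<notin> E \<and> (w, v) \<notin> E}"
    have "card {w \<in> U. w \<noteq> v \<and> (v, w) \<notin> E - \<beta> - Z \<and> (w, v) \<notin> E - \<beta> - Z} \<le>
        card (?N \<union> \<beta> `` {v} \<union> Z `` {v} \<union> \<beta>\<inverse> `` {v} \<union> Z\<inverse> `` {v})"
      using finite_V assms(1) Z by (intro card_mono) (auto simp: U_def)
    also have "\<dots> \<le> card ?N + card (\<beta> `` {v}) + card (Z `` {v}) + card (\<beta>\<inverse> `` {v}) + card (Z\<inverse> `` {v})"
      by (intro order_trans[OF card_Un_le] add_mono card_Un_le order_refl)
    also have "\<dots> \<le> \<Delta> + t v + m + t v + m"
      using v \<beta>[of v] Z[of v] non_neighbours[of v] by (intro add_mono) (auto simp: U_def)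
    also have "\<dots> \<le> \<Delta> + 2 * k" using v by (simp add: U_def)
    finally show ?thesis .
  qed
  moreover have "finite U" using finite_V by (simp add: U_def)
  ultimately have "\<exists>T' Ss' Es'. T' \<subseteq> E - \<beta> - Z \<and> path_system T' U (Suc (\<Delta> + 2 * k)) Ss' Es'"
    by (intro path_system_exists) blast+
  then obtain T' Ss' Es' where T': "T' \<subseteq> E - \<beta> - Z" "path_system T' U (Suc (\<Delta> + 2 * k)) Ss' Es'"
    by (elim exE conjE that)
  show ?case
  proof (rule exI[of _ "T(m := T')"], rule exI[of _ "Ss(m := Ss')"], rule exI[of _ "Es(m := Es')"],
      intro conjI allI impI)
    show "(T(m := T')) j \<subseteq> E - \<beta>" if "j < Suc m" for j
      using T(1)[of j] T'(1) that by auto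
    show "path_system ((T(m := T')) j) {v \<in> V - S. t v + j < k} (\<Delta> + 2 * k + 1)
        ((Ss(m := Ss')) j) ((Es(m := Es')) j)" if "j < Suc m" for j
      using that T(2)[of j] T'(2) by (auto simp: U_def less_Suc_eq)
    show "(T(m := T')) i \<inter> (T(m := T')) j = {}" if "i < Suc m" "j < Suc m" "i \<noteq> j" for i j
      using T(3)[of i j] T'(1) that unfolding Z_def by (auto simp: less_Suc_eq)
  qed
qed simp

text \<open>The links are chosen greedily. \<open>\<Lambda>\<close> and \<open>M\<close> collect the first and the middle edges of the links
  so far; vertices with \<open>k\<close> outgoing middle edges are not used as first intermediate vertex any more.
  The last edges of links to different hubs differ, because no intermediate vertex is a hub.\<close>

lemma disjoint_links:
  assumes k: "k \<ge> 1" and "finite \<beta>"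
    and \<beta>: "\<And>v. card (\<beta> `` {v}) \<le> k" "\<And>v. card (\<beta>\<inverse> `` {v}) \<le> k"
    and h: "inj_on h {..<k}" "h ` {..<k} \<subseteq> V"
    and "finite L"
    and deg: "\<And>u j. j < k \<Longrightarrow> u \<in> V \<Longrightarrow> u \<notin> L \<Longrightarrow> u \<notin> h ` {..<k} \<Longrightarrow>
      card (E\<inverse> `` {u}) \<le> card (E\<inverse> `` {h j})"
    and Rq: "finite R" "R \<subseteq> V \<times> {..<k}" "card R \<le> k * r"
    and large: "\<And>e j. (e, j) \<in> R \<Longrightarrow> 15 * k + r + card L + 3 * \<Delta> + 3 \<le> card (E `` {e})"
  shows "\<exists>G. (\<forall>j. G j \<subseteq> E - \<beta>) \<and> (\<forall>i<k. \<forall>j<k. i \<noteq> j \<longrightarrow> G i \<inter> G j = {}) \<and>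
    (\<forall>(e, j)\<in>R. (e, h j) \<in> (G j)\<^sup>*) \<and> (\<Sum>j<k. card (G j)) \<le> 3 * card R"
proof -
  define Hb where "Hb = h ` {..<k}"
  have Hb: "finite Hb" "card Hb \<le> k"
    unfolding Hb_def using card_image_le[of "{..<k}" h] by auto
  have hne: "h i \<noteq> h j" if "i < k" "j < k" "i \<noteq> j" for i j
    using h(1) that by (auto simp: inj_on_def)
  have hHb: "h j \<in> Hb" if "j < k" for j using that by (simp add: Hb_def)
  \<comment> \<open>The invariant of the greedy choice. Out-degrees in \<open>\<Lambda>\<close> are
    bounded by the number of requests at the vertex, those in \<open>M\<close> by \<open>k\<close>;
    besides such edges \<open>G j\<close> contains only edges into its own hub.\<close>
  define ok where "ok R' G M \<Lambda> \<longleftrightarrow> (\<forall>j. G j \<subseteq> E - \<beta>) \<and> (\<forall>i<k. \<forall>j<k. i \<noteq> j \<longrightarrow> G i \<inter> G j = {}) \<and>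
      (\<forall>(e, j)\<in>R'. (e, h j) \<in> (G j)\<^sup>*) \<and> (\<Sum>j<k. card (G j)) \<le> 3 * card R' \<and>
      finite M \<and> finite \<Lambda> \<and> card M \<le> card R' \<and> (\<forall>x. card (M `` {x}) \<le> k) \<and>
      (\<forall>x. card (\<Lambda> `` {x}) \<le> card {j. (x, j) \<in> R'}) \<and>
      snd ` (M \<union> \<Lambda>) \<inter> Hb = {} \<and> (\<forall>j<k. G j \<subseteq> M \<union> \<Lambda> \<union> UNIV \<times> {h j})"
    for R' G M \<Lambda>
  have "\<exists>G M \<Lambda>. ok R' G M \<Lambda>" if "finite R'" "R' \<subseteq> R" for R'
    using that
  proof (induction R' rule: finite_induct)
    case empty
    show ?case unfolding ok_def by (intro exI[of _ "\<lambda>_. {}"] exI[of _ "{}"]) auto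
  next
    case (insert ej R')
    obtain e j where ej: "ej = (e, j)" by (cases ej)
    have ejR: "(e, j) \<in> R" "j < k" "e \<in> V" "(e, j) \<notin> R'"
      using insert.prems insert.hyps Rq(2) ej by auto
    obtain G M \<Lambda> where okG: "ok R' G M \<Lambda>" using insert.IH insert.prems by blast
    have G': "\<forall>j. G j \<subseteq> E - \<beta>" "\<forall>i<k. \<forall>j<k. i \<noteq> j \<longrightarrow> G i \<inter> G j = {}"
        "\<forall>(e, j)\<in>R'. (e, h j) \<in> (G j)\<^sup>*" "(\<Sum>j<k. card (G j)) \<le> 3 * card R'"
      and M: "finite M" "card M \<le> card R'" "\<forall>x. card (M `` {x}) \<le> k"
      and \<Lambda>: "finite \<Lambda>" "\<forall>x. card (\<Lambda> `` {x}) \<le> card {j. (x, j) \<in> R'}"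
      and avoid: "snd ` (M \<union> \<Lambda>) \<inter> Hb = {}"
      and shape: "\<forall>j<k. G j \<subseteq> M \<union> \<Lambda> \<union> UNIV \<times> {h j}"
      using okG unfolding ok_def by - (elim conjE, assumption)+
    have G: "\<And>j. G j \<subseteq> E - \<beta>"
        "\<And>i j. i < k \<Longrightarrow> j < k \<Longrightarrow> i \<noteq> j \<Longrightarrow> G i \<inter> G j = {}"
        "\<And>e j. (e, j) \<in> R' \<Longrightarrow> (e, h j) \<in> (G j)\<^sup>*" "(\<Sum>j<k. card (G j)) \<le> 3 * card R'"
      using G' by auto
    note M(3)[rule_format] and \<Lambda>(2)[rule_format] and shape[rule_format]
    note M = M(1,2) this(1) and \<Lambda> = \<Lambda>(1) this(2) and shape = this(3)
    \<comment> \<open>The saturated vertices; as \<open>M\<close> has at most \<open>k * r\<close>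
      edges, there are at most \<open>r\<close> of them.\<close>
    define Ov where "Ov = {u. k \<le> card (M `` {u})}"
    have finOv: "finite Ov"
      using card_overused[OF M(1) k] by (simp add: Ov_def)
    have "card Ov * k \<le> card M"
      using card_overused[OF M(1) k] by (simp add: Ov_def)
    also have "card M \<le> k * r"
      using M(2) card_mono[OF Rq(1), of R'] insert.prems Rq(3) by auto
    finally have Ov: "card Ov \<le> r" using k by (simp add: mult.commute)
    define F where "F = \<beta> \<union> M \<union> \<Lambda>"
    have "card {j. (x, j) \<in> R'} \<le> k" for x
      using card_mono[of "{..<k}" "{j. (x, j) \<in> R'}"] insert.prems Rq(2) by auto
    then have Fout: "card (F `` {x}) \<le> 3 * k" for x
      using card_Un_le[of "\<beta> `` {x} \<union> M `` {x}" "\<Lambda> `` {x}"] card_Un_le[of "\<beta> `` {x}" "M `` {x}"]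
        \<beta>(1)[of x] M(3)[of x] \<Lambda>(2)[of x] order_trans
      unfolding F_def Un_Image by fastforce
    \<comment> \<open>No earlier first or middle edge enters a hub. Earlier last edges into
      \<open>h j\<close> remain available: they lie in \<open>G j\<close> itself, where reuse is
      harmless.\<close>
    have "F\<inverse> `` {h j} = \<beta>\<inverse> `` {h j}"
      using avoid hHb[OF ejR(2)] unfolding F_def by force
    then have Fin: "card (F\<inverse> `` {h j}) \<le> k" using \<beta>(2) by simp
    have "card (L \<union> Hb \<union> Ov) \<le> card L + k + r"
      using card_Un_le[of "L \<union> Hb" Ov] card_Un_le[of L Hb] Hb Ov by linarith
    \<comment> \<open>The degree required is \<open>3 * k + (card L + k + r) + k + 3 * \<Delta> + 2
      * (3 * k + k + k) + 3\<close>, which is what \<open>large\<close> supplies.\<close>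
    then have "\<exists>u. u \<notin> L \<union> Hb \<union> Ov \<and> (e, u) \<in> E - F \<and>
        ((u, h j) \<in> E - F \<or> (\<exists>w. w \<notin> Hb \<and> (u, w) \<in> E - F \<and> (w, h j) \<in> E - F))"
      using ejR h(2) deg[OF ejR(2)] \<open>finite L\<close> Hb finOv Fout Fin large[OF ejR(1)] assms(2) M(1) \<Lambda>(1)
      by (intro short_link[where f = "3 * k" and fe = "3 * k" and ft = k])
        (auto simp: Hb_def F_def)
    then obtain u P' M' where u: "u \<notin> Hb" "u \<notin> Ov" "(e, u) \<in> E - F"
      and M': "M' = {} \<or> (\<exists>w. w \<notin> Hb \<and> M' = {(u, w)})"
      and P': "P' \<subseteq> E - \<beta>" "finite P'" "card P' \<le> 3" "(e, h j) \<in> P'\<^sup>*"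
        "P' \<subseteq> insert (e, u) M' \<union> UNIV \<times> {h j}" "P' \<inter> (M \<union> \<Lambda>) = {}"
    proof (elim exE conjE disjE)
      fix u assume *: "u \<notin> L \<union> Hb \<union> Ov" "(e, u) \<in> E - F" "(u, h j) \<in> E - F"
      have "(e, h j) \<in> {(e, u), (u, h j)}\<^sup>*"
        by (meson insertCI r_into_rtrancl rtrancl_trans)
      with * show thesis
        by (intro that[of u "{}" "{(e, u), (u, h j)}"]) (auto simp: F_def card_insert_if)
    next
      fix u w assume *: "u \<notin> L \<union> Hb \<union> Ov" "(e, u) \<in> E - F" "w \<notin> Hb" "(u, w) \<in> E - F" "(w, h j) \<in> E - F"
      have "(e, h j) \<in> {(e, u), (u, w), (w, h j)}\<^sup>*"
        by (meson insertCI r_into_rtrancl rtrancl_trans)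
      with * show thesis
        by (intro that[of u "{(u, w)}" "{(e, u), (u, w), (w, h j)}"]) (auto simp: F_def card_insert_if)
    qed
    define G' where "G' = G(j := G j \<union> P')"
    have "(\<Sum>i<k. card (G' i)) = card (G' j) + (\<Sum>i\<in>{..<k} - {j}. card (G' i))"
      using ejR by (intro sum.remove) auto
    also have "\<dots> \<le> card (G j) + 3 + (\<Sum>i\<in>{..<k} - {j}. card (G i))"
      using P'(3) card_Un_le[of "G j" P'] by (auto simp: G'_def intro!: add_mono)
    also have "\<dots> = (\<Sum>i<k. card (G i)) + 3"
      using ejR by (simp add: sum.remove[of "{..<k}" j])
    finally have cardG': "(\<Sum>i<k. card (G' i)) \<le> 3 * card (insert ej R')"
      using G(4) insert.hyps by simp
    \<comment> \<open>The new link avoids \<open>M\<close> and \<open>\<Lambda>\<close>, and those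
      of its edges that enter a hub all enter \<open>h j\<close>.\<close>
    have new: "P' \<inter> G i = {}" if "i < k" "i \<noteq> j" for i
    proof -
      have "P' \<inter> UNIV \<times> {h i} = {}"
        using P'(5) u(1) M' hHb[OF that(1)] hne[OF that(1) ejR(2) that(2)] by auto
      with shape[OF that(1)] P'(6) show ?thesis by blast
    qed
    show ?case
      unfolding ok_def
    proof (rule exI[of _ G'], rule exI[of _ "M \<union> M'"], rule exI[of _ "insert (e, u) \<Lambda>"],
        intro conjI allI impI)
      show "G' i \<subseteq> E - \<beta>" for i using G(1) P'(1) by (auto simp: G'_def)
      show "G' i \<inter> G' l = {}" if "i < k" "l < k" "i \<noteq> l" for i l
        using G(2)[OF that] new[of i] new[of l] that by (auto simp: G'_def)
      have "(e, h j) \<in> (G j \<union> P')\<^sup>*" using P'(4) by (metis Un_upper2 in_mono rtrancl_mono)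
      moreover have "(e', h j) \<in> (G j \<union> P')\<^sup>*" if "(e', j) \<in> R'" for e'
        using G(3)[OF that] by (metis Un_upper1 in_mono rtrancl_mono)
      ultimately show "\<forall>(e, i)\<in>insert ej R'. (e, h i) \<in> (G' i)\<^sup>*"
        using G(3) by (auto simp: G'_def ej)
      show "finite (M \<union> M')" using M M' by auto
      show "finite (insert (e, u) \<Lambda>)" using \<Lambda> by simp
      have "card M' \<le> 1" using M' by auto
      then show "card (M \<union> M') \<le> card (insert ej R')"
        using M(2) card_Un_le[of M M'] insert.hyps by simp
      show "card ((M \<union> M') `` {x}) \<le> k" for x
      proof (cases "x = u \<and> M' \<noteq> {}")
        case True
        then obtain w where "M' = {(u, w)}" using M' by auto
        then have "(M \<union> M') `` {x} = insert w (M `` {x})" using True by auto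
        then have "card ((M \<union> M') `` {x}) \<le> Suc (card (M `` {x}))"
          by (simp add: card_insert_le_m1)
        also have "\<dots> \<le> k" using u(2) True by (simp add: Ov_def)
        finally show ?thesis .
      next
        case False
        then have "(M \<union> M') `` {x} = M `` {x}" using M' by auto
        then show ?thesis using M(3) by simp
      qed
      show "card (insert (e, u) \<Lambda> `` {x}) \<le> card {j. (x, j) \<in> insert ej R'}" for x
      proof (cases "x = e")
        case True
        have fin: "finite {i. (e, i) \<in> R'}"
          by (rule finite_subset[of _ "snd ` R'"]) (use insert.hyps(1) in force)+
        have "insert (e, u) \<Lambda> `` {x} = insert u (\<Lambda> `` {x})" using True by auto
        then have "card (insert (e, u) \<Lambda> `` {x}) \<le> Suc (card (\<Lambda> `` {x}))"
          by (simp add: card_insert_le_m1)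
        also have "\<dots> \<le> Suc (card {i. (e, i) \<in> R'})" using \<Lambda>(2) True by simp
        also have "\<dots> = card (insert j {i. (e, i) \<in> R'})"
          using fin ejR(4) by simp
        also have "insert j {i. (e, i) \<in> R'} = {i. (x, i) \<in> insert ej R'}"
          using True ej by auto
        finally show ?thesis .
      next
        case False
        then have "insert (e, u) \<Lambda> `` {x} = \<Lambda> `` {x}" "{j. (x, j) \<in> insert ej R'} = {j. (x, j) \<in> R'}"
          using ej by auto
        then show ?thesis using \<Lambda>(2) by simp
      qed
      show "snd ` (M \<union> M' \<union> insert (e, u) \<Lambda>) \<inter> Hb = {}"
        using avoid u(1) M' by auto
      show "G' i \<subseteq> M \<union> M' \<union> insert (e, u) \<Lambda> \<union> UNIV \<times> {h i}" if "i < k" for i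
        using shape[OF that] P'(5) by (auto simp: G'_def)
      show "(\<Sum>j<k. card (G' j)) \<le> 3 * card (insert ej R')" by (rule cardG')
    qed
  qed
  then obtain G M \<Lambda> where "ok R G M \<Lambda>" using Rq(1) by blast
  then show ?thesis
    unfolding ok_def by - (rule exI[of _ G], (intro conjI; elim conjE; assumption))
qed

end

text \<open>As \<open>Z\<close> shares no pair with \<open>P\<close>, one copy of each of its pairs
  fits into \<open>H\<close> beside \<open>P\<close>. Hence flow edges and path edges may be counted
  separately.\<close>

lemma card_leaving_le_cut_out:
  assumes "P \<subseteq># H" "finite Z" "Z \<subseteq> set_mset H" "Z \<inter> set_mset P = {}"
  shows "cut_out P X + card {p \<in> Z. fst p \<in> X \<and> snd p \<notin> X} \<le> cut_out H X"
proof -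
  have "count P p + count (mset_set Z) p \<le> count H p" for p
  proof (cases "p \<in> Z")
    case True
    then have "count P p = 0" "1 \<le> count H p"
      using assms by (auto simp: Suc_le_eq simp flip: not_in_iff)
    then show ?thesis using True assms(2) by simp
  next
    case False
    then show ?thesis using assms(1) by (simp add: mset_subset_eq_count)
  qed
  then have "P + mset_set Z \<subseteq># H" by (simp add: mset_subset_eqI)
  moreover have "cut_out (mset_set Z) X = card {p \<in> Z. fst p \<in> X \<and> snd p \<notin> X}"
    using assms(2) by (simp add: cut_out_def)
  ultimately show ?thesis
    using cut_out_mono[of "P + mset_set Z" H X] by (simp add: cut_out_add)
qed

lemma card_Image_le_odeg: "card (set_mset P `` {v}) \<le> odeg P v"
proof -
  have "set_mset P `` {v} = snd ` set_mset {#e \<in># P. fst e = v#}" by force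
  then have "card (set_mset P `` {v}) \<le> card (set_mset {#e \<in># P. fst e = v#})"
    by (simp add: card_image_le)
  also have "\<dots> \<le> odeg P v"
    unfolding odeg_def by (metis mset_set_set_mset_msubset size_mset_mono size_mset_set)
  finally show ?thesis .
qed

lemma exists_leaving_edge:
  assumes "(x, y) \<in> R\<^sup>*" "x \<in> X" "y \<notin> X"
  shows "\<exists>p\<in>R. fst p \<in> X \<and> snd p \<notin> X"
  using assms by (induction rule: rtrancl_induct) force+

section \<open>Leaving the sets that avoid \<open>b\<close>\<close>

context dense_digraph
begin

text \<open>The vertex \<open>v\<close> has path edges only in levels \<open>j < k - t v\<close>, at
  most one in each, beside at most \<open>t v\<close> edges of \<open>\<beta>\<close>.\<close>

lemma card_base_out:
  assumes T: "\<And>j. j < k \<Longrightarrow> path_system (T j) {v \<in> V - S. t v + j < k} r (Ss j) (Es j)"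
    and "finite \<beta>" "card (\<beta> `` {v}) \<le> t v" "t v \<le> k"
  shows "card ((\<beta> \<union> (\<Union>j<k. T j)) `` {v}) \<le> k"
proof -
  have "(\<Union>j<k. T j) `` {v} = (\<Union>j<k - t v. T j) `` {v}"
  proof -
    have "j < k - t v" if "j < k" "(v, y) \<in> T j" for j y
      using T[OF that(1)] that(2) by (auto simp: path_system_def)
    then show ?thesis by fastforce
  qed
  moreover have "single_valued (T j)" if "j < k" for j
    using T[OF that] by (simp add: path_system_def)
  ultimately have "card ((\<Union>j<k. T j) `` {v}) \<le> k - t v"
    using card_Image_UN_single_valued(2)[of "k - t v" T v] by simp
  then show ?thesis
    using card_Un_le[of "\<beta> `` {v}" "(\<Union>j<k. T j) `` {v}"] assms(3,4) by (simp add: Un_Image)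
qed

text \<open>Large in-degree makes hubs suitable targets for \<open>short_link\<close>. They are
  chosen outside \<open>L\<close>, later the set of vertices of small out-degree, so that they can
  in turn be linked to \<open>b\<close>.\<close>

lemma exists_hubs:
  assumes "card L + k \<le> card V" "L \<subseteq> V"
  obtains h :: "nat \<Rightarrow> 'a" where "inj_on h {..<k}" "h ` {..<k} \<subseteq> V - L"
    "\<And>u j. j < k \<Longrightarrow> u \<in> V \<Longrightarrow> u \<notin> L \<Longrightarrow> u \<notin> h ` {..<k} \<Longrightarrow>
      card (E\<inverse> `` {u}) \<le> card (E\<inverse> `` {h j})"
proof -
  have "k \<le> card (V - L)"
    using assms finite_V by (simp add: card_Diff_subset finite_subset)
  then obtain B where B: "B \<subseteq> V - L" "card B = k"
    "\<forall>b\<in>B. \<forall>u\<in>V - L - B. card (E\<inverse> `` {u}) \<le> card (E\<inverse> `` {b})"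
    using top_elements[of "V - L" k "\<lambda>u. card (E\<inverse> `` {u})"] finite_V by auto
  have "finite B" using B(1) finite_V by (meson finite_Diff finite_subset)
  then obtain h where "bij_betw h {..<k} B"
    using ex_bij_betw_nat_finite[of B] B(2) by (auto simp: atLeast0LessThan)
  then show thesis
    using B by (intro that[of h]) (auto simp: bij_betw_def)
qed

text \<open>A set \<open>X\<close> avoiding \<open>b\<close>, \<open>a\<close> and all hubs is left by the flow \<open>P\<close> at least \<open>odeg P v\<close> times, and by
  each of the \<open>k - odeg P v\<close> path systems through \<open>v\<close> together with its links to a hub.\<close>

lemma out_connections:
  assumes k: "k \<ge> 1" and ab: "a \<in> V" "b \<in> V"
    and bmax: "\<And>u. u \<in> V \<Longrightarrow> card (E\<inverse> `` {u}) \<le> card (E\<inverse> `` {b})"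
    and adeg: "18 * k + 3 * \<Delta> \<le> card (E `` {a})"
    and big: "37 * k + 7 * \<Delta> \<le> card V"
    and S: "\<And>v. v \<in> V - S \<Longrightarrow> 57 * k + 11 * \<Delta> \<le> card (E `` {v})"
    and P: "\<And>v. odeg P v \<le> k" "\<And>v. ideg P v \<le> k" "\<And>v. v \<in> V - S \<Longrightarrow> odeg P v = ideg P v"
    and Pcut: "\<And>v X. v \<in> X \<Longrightarrow> a \<notin> X \<Longrightarrow> odeg P v \<le> cut_out P X"
    and T: "\<And>j. j < k \<Longrightarrow> T j \<subseteq> E - set_mset P"
      "\<And>j. j < k \<Longrightarrow> path_system (T j) {v \<in> V - S. odeg P v + j < k} (\<Delta> + 2 * k + 1) (Ss j) (Es j)"
      "\<And>i j. i < k \<Longrightarrow> j < k \<Longrightarrow> i \<noteq> j \<Longrightarrow> T i \<inter> T j = {}"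
  shows "\<exists>Q\<subseteq>E. card Q \<le> 3 * k * (\<Delta> + 2 * k + 1) + 3 * k * (k + 1) \<and>
    (\<forall>H X. P \<subseteq># H \<longrightarrow> Q \<union> (\<Union>j<k. T j) \<subseteq> set_mset H \<longrightarrow> b \<notin> X \<longrightarrow>
      (X \<inter> (V - S) \<noteq> {} \<or> a \<in> X) \<longrightarrow> k \<le> cut_out H X)"
proof -
  define r where "r = \<Delta> + 2 * k + 1"
  \<comment> \<open>The threshold is the out-degree that \<open>robust_link\<close> requires; by
    \<open>card_small_outdegree\<close> the assumption \<open>big\<close> leaves room for
    \<open>k\<close> hubs outside \<open>L\<close>.\<close>
  define L where "L = {v \<in> V. card (E `` {v}) < 18 * k + 3 * \<Delta>}"
  have L: "card L \<le> 36 * k + 7 * \<Delta>" "finite L" "L \<subseteq> V"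
    using card_small_outdegree[of "18 * k + 3 * \<Delta>"] finite_V by (auto simp: L_def)
  obtain h :: "nat \<Rightarrow> 'a" where h: "inj_on h {..<k}" "h ` {..<k} \<subseteq> V - L"
    "\<And>u j. j < k \<Longrightarrow> u \<in> V \<Longrightarrow> u \<notin> L \<Longrightarrow> u \<notin> h ` {..<k} \<Longrightarrow>
      card (E\<inverse> `` {u}) \<le> card (E\<inverse> `` {h j})"
    using exists_hubs[of L k] L big by (auto simp: le_trans)
  define \<beta> where "\<beta> = set_mset P \<union> (\<Union>j<k. T j)"
  have finT: "finite (T j)" if "j < k" for j
    using T(1)[OF that] finite_E by (meson finite_Diff finite_subset)
  then have fin\<beta>: "finite \<beta>" by (auto simp: \<beta>_def)
  have \<beta>out: "card (\<beta> `` {v}) \<le> k" for v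
    unfolding \<beta>_def by (rule card_base_out[OF T(2)]) (simp_all add: card_Image_le_odeg P(1))
  \<comment> \<open>The same count in the reversed graph; by conservation on \<open>V - S\<close>
    the levels for \<open>ideg P\<close> and \<open>odeg P\<close> coincide.\<close>
  have \<beta>in: "card (\<beta>\<inverse> `` {v}) \<le> k" for v
  proof -
    have "path_system ((T j)\<inverse>) {v \<in> V - S. ideg P v + j < k} r (Es j) (Ss j)" if "j < k" for j
    proof -
      have "{v \<in> V - S. ideg P v + j < k} = {v \<in> V - S. odeg P v + j < k}" using P(3) by auto
      then show ?thesis using path_system_converse[OF T(2)[OF that]] by (simp add: r_def)
    qed
    moreover have "\<beta>\<inverse> = set_mset (rev_edges P) \<union> (\<Union>j<k. (T j)\<inverse>)"
      unfolding set_rev_edges by (auto simp: \<beta>_def)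
    moreover have "card (set_mset (rev_edges P) `` {v}) \<le> ideg P v"
      using card_Image_le_odeg[of "rev_edges P" v] by (simp only: odeg_rev)
    ultimately show ?thesis
      using P(2)[of v] card_base_out[of k "\<lambda>j. (T j)\<inverse>" S "ideg P" r Es Ss "set_mset (rev_edges P)" v]
      by simp
  qed
  \<comment> \<open>One request for each level \<open>j\<close> and each end \<open>e\<close> of one
    of its paths.\<close>
  define R where "R = (SIGMA e:V. {j. j < k \<and> e \<in> Es j})"
  have EsV: "Es j \<subseteq> V - S" "card (Es j) \<le> r" if "j < k" for j
    using T(2)[OF that] by (auto simp: path_system_def r_def)
  have Rsub: "R \<subseteq> V \<times> {..<k}" by (auto simp: R_def)
  then have finR: "finite R" using finite_V by (meson finite_SigmaI finite_lessThan finite_subset)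
  have "card R = card (SIGMA j:{..<k}. Es j)"
    using EsV(1) by (intro bij_betw_same_card[of prod.swap]) (force simp: bij_betw_def R_def inj_on_def image_iff)
  also have "\<dots> = (\<Sum>j<k. card (Es j))"
    using EsV(1) finite_V by (intro card_SigmaI) (auto intro: finite_subset)
  also have "\<dots> \<le> k * r"
    using sum_bounded_above[of "{..<k}" "\<lambda>j. card (Es j)" r] EsV(2) by simp
  finally have cardR: "card R \<le> k * r" .
  \<comment> \<open>The left side is at most \<open>53 * k + 11 * \<Delta> + 4\<close>, and
    \<open>k \<ge> 1\<close> absorbs the 4.\<close>
  have large: "15 * k + r + card L + 3 * \<Delta> + 3 \<le> card (E `` {e})" if "(e, j) \<in> R" for e j
  proof -
    have "57 * k + 11 * \<Delta> \<le> card (E `` {e})"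
      using that EsV(1) by (intro S) (auto simp: R_def)
    then show ?thesis using L(1) k by (simp add: r_def)
  qed
  have "\<exists>G. (\<forall>j. G j \<subseteq> E - \<beta>) \<and> (\<forall>i<k. \<forall>j<k. i \<noteq> j \<longrightarrow> G i \<inter> G j = {}) \<and>
    (\<forall>(e, j)\<in>R. (e, h j) \<in> (G j)\<^sup>*) \<and> (\<Sum>j<k. card (G j)) \<le> 3 * card R"
  proof (rule disjoint_links[OF k fin\<beta> \<beta>out \<beta>in h(1) _ L(2) h(3) finR Rsub cardR large])
    show "h ` {..<k} \<subseteq> V" using h(2) by blast
  qed
  then obtain G where G: "\<forall>j. G j \<subseteq> E - \<beta>" "\<forall>i<k. \<forall>j<k. i \<noteq> j \<longrightarrow> G i \<inter> G j = {}"
    "\<forall>(e, j)\<in>R. (e, h j) \<in> (G j)\<^sup>*" "(\<Sum>j<k. card (G j)) \<le> 3 * card R"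
    by (elim exE conjE that)
  \<comment> \<open>\<open>a\<close> joins the hubs so that sets containing \<open>a\<close> are
    covered even if they contain no hub and no other vertex outside \<open>S\<close>.\<close>
  define C where "C = insert a (h ` {..<k})"
  have "\<exists>Q. Q \<subseteq> E \<and> card Q \<le> 3 * k \<and>
      (\<forall>X. c \<in> X \<longrightarrow> b \<notin> X \<longrightarrow> k \<le> card {p \<in> Q. fst p \<in> X \<and> snd p \<notin> X})" if "c \<in> C" for c
    using that ab adeg bmax h(2) by (intro robust_link) (auto simp: C_def L_def not_less)
  then obtain q where "\<forall>c\<in>C. q c \<subseteq> E \<and> card (q c) \<le> 3 * k \<and>
      (\<forall>X. c \<in> X \<longrightarrow> b \<notin> X \<longrightarrow> k \<le> card {p \<in> q c. fst p \<in> X \<and> snd p \<notin> X})"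
    by (elim bchoice[OF ballI, elim_format] exE)
  then have q: "\<And>c. c \<in> C \<Longrightarrow> q c \<subseteq> E" "\<And>c. c \<in> C \<Longrightarrow> card (q c) \<le> 3 * k"
    "\<And>c X. c \<in> C \<Longrightarrow> c \<in> X \<Longrightarrow> b \<notin> X \<Longrightarrow> k \<le> card {p \<in> q c. fst p \<in> X \<and> snd p \<notin> X}"
    by blast+
  have finC: "finite C" and "card C \<le> k + 1"
    using card_image_le[of "{..<k}" h] card_insert_le_m1[of "k + 1" "h ` {..<k}" a]
    by (auto simp: C_def)
  define Q where "Q = (\<Union>j<k. G j) \<union> (\<Union>c\<in>C. q c)"
  show ?thesis
  proof (intro exI[of _ Q] conjI allI impI)
    show QE: "Q \<subseteq> E" using G(1) q(1) by (auto simp: Q_def)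
    have "card (\<Union>j<k. G j) \<le> 3 * k * r"
      using card_UN_le[of "{..<k}" G] G(4) cardR by simp
    moreover have "card (\<Union>c\<in>C. q c) \<le> 3 * k * (k + 1)"
    proof -
      have "card (\<Union>c\<in>C. q c) \<le> (\<Sum>c\<in>C. card (q c))" using finC by (rule card_UN_le)
      also have "\<dots> \<le> card C * (3 * k)" using sum_bounded_above[of C "\<lambda>c. card (q c)" "3 * k"] q(2) by simp
      also have "\<dots> \<le> (k + 1) * (3 * k)" using \<open>card C \<le> k + 1\<close> by (rule mult_le_mono1)
      finally show ?thesis by (simp add: mult.commute)
    qed
    ultimately show "card Q \<le> 3 * k * (\<Delta> + 2 * k + 1) + 3 * k * (k + 1)"
      using card_Un_le[of "\<Union>j<k. G j" "\<Union>c\<in>C. q c"] unfolding Q_def r_def by linarith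
    fix H X
    assume H: "P \<subseteq># H" "Q \<union> (\<Union>j<k. T j) \<subseteq> set_mset H" and bX: "b \<notin> X"
      and X: "X \<inter> (V - S) \<noteq> {} \<or> a \<in> X"
    show "k \<le> cut_out H X"
    proof (cases "X \<inter> C = {}")
      case False
      then obtain c where c: "c \<in> C" "c \<in> X" by auto
      then have "finite (q c)" "q c \<subseteq> set_mset H"
        using H(2) finite_subset[OF q(1) finite_E] by (auto simp: Q_def)
      then show ?thesis
        using card_leaving_le_cut_out[of "{#}" H "q c" X] q(3)[OF c bX] by simp
    next
      case True
      then obtain v where v: "v \<in> X" "v \<in> V - S" using X by (auto simp: C_def)
      \<comment> \<open>The levels \<open>j < m\<close> are those containing \<open>v\<close>. Each
        contributes a leaving edge on the way from \<open>v\<close> to \<open>h j\<close>, and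
        disjointness of the levels makes these edges distinct.\<close>
      define m where "m = k - odeg P v"
      have "\<exists>p\<in>T j \<union> G j. fst p \<in> X \<and> snd p \<notin> X" if "j < m" for j
      proof -
        have j: "j < k" "odeg P v + j < k" using that by (auto simp: m_def)
        then obtain e where e: "e \<in> Es j" "(v, e) \<in> (T j)\<^sup>*"
          using T(2)[OF j(1)] v(2) unfolding path_system_def by blast
        then have "(e, h j) \<in> (G j)\<^sup>*" using G(3) j(1) EsV(1) by (auto simp: R_def)
        then have "(v, h j) \<in> (T j \<union> G j)\<^sup>*"
          using e(2) by (meson Un_upper1 Un_upper2 in_mono rtrancl_mono rtrancl_trans)
        moreover have "h j \<notin> X" using True j(1) by (auto simp: C_def)
        ultimately show ?thesis using v(1) by (intro exists_leaving_edge)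
      qed
      then obtain f where f: "\<And>j. j < m \<Longrightarrow> f j \<in> T j \<union> G j"
        "\<And>j. j < m \<Longrightarrow> fst (f j) \<in> X \<and> snd (f j) \<notin> X"
        by metis
      have disj: "(T i \<union> G i) \<inter> (T j \<union> G j) = {}" if "i < k" "j < k" "i \<noteq> j" for i j
        using T(3)[OF that] G(2) that G(1) unfolding \<beta>_def by blast
      define Z where "Z = (\<Union>j<k. T j \<union> G j)"
      have Z: "finite Z" "Z \<subseteq> set_mset H" "Z \<inter> set_mset P = {}"
      proof -
        have "Z \<subseteq> E" using T(1) G(1) by (auto simp: Z_def)
        then show "finite Z" using finite_E finite_subset by blast
        show "Z \<subseteq> set_mset H" using H(2) by (auto simp: Z_def Q_def)
        show "Z \<inter> set_mset P = {}" using T(1) G(1) by (fastforce simp: Z_def \<beta>_def)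
      qed
      have mk: "m \<le> k" by (simp add: m_def)
      have "inj_on f {..<m}"
      proof (rule inj_onI, rule ccontr)
        fix i j assume ij: "i \<in> {..<m}" "j \<in> {..<m}" "f i = f j" "i \<noteq> j"
        then show False using disj[of i j] f(1)[of i] f(1)[of j] mk by auto
      qed
      moreover have "f ` {..<m} \<subseteq> {p \<in> Z. fst p \<in> X \<and> snd p \<notin> X}"
        using f mk by (fastforce simp: Z_def)
      ultimately have "m \<le> card {p \<in> Z. fst p \<in> X \<and> snd p \<notin> X}"
        using card_inj_on_le[of f "{..<m}"] Z(1) by simp
      moreover have "odeg P v \<le> cut_out P X"
        using Pcut[OF v(1)] True by (auto simp: C_def)
      ultimately show ?thesis
        using card_leaving_le_cut_out[OF H(1) Z, of X] by (simp add: m_def)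
    qed
  qed
qed

end

section \<open>The sparse subgraph\<close>

lemma cut_out_restrict:
  assumes "set_mset M \<subseteq> V \<times> V"
  shows "cut_out M (X \<inter> V) = cut_out M X"
  unfolding cut_out_def using assms by (intro arg_cong[of _ _ size] filter_mset_cong) auto

text \<open>Serves the sets lying within \<open>S\<close> and those missing only vertices of
  \<open>S\<close>. Leaving out \<open>b\<close>, respectively \<open>a\<close>, keeps these sets
  proper, so that \<open>con\<close> applies.\<close>

lemma boundary_cover:
  assumes E: "set_mset E \<subseteq> V \<times> V" and "finite V"
    and con: "\<And>X. X \<inter> V \<noteq> {} \<Longrightarrow> \<not> V \<subseteq> X \<Longrightarrow> k \<le> cut_out E X"
    and ab: "a \<in> V" "b \<in> V" and "S \<subseteq> V"
  obtains M where "M \<subseteq># E" "size M \<le> 2 * k * card S"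
    "\<And>X. X \<inter> V \<noteq> {} \<Longrightarrow> X \<inter> V \<subseteq> S - {b} \<Longrightarrow> k \<le> cut_out M X"
    "\<And>X. \<not> V \<subseteq> X \<Longrightarrow> V - X \<subseteq> S - {a} \<Longrightarrow> k \<le> cut_out M X"
proof -
  have fin: "finite S" using assms finite_subset by blast
  have "k \<le> cut_out E X" if "X \<noteq> {}" "X \<subseteq> S - {b}" for X
    using that ab \<open>S \<subseteq> V\<close> by (intro con) auto
  then obtain M1 where M1: "M1 \<subseteq># E" "size M1 \<le> k * card (S - {b})"
    "\<And>X. X \<noteq> {} \<Longrightarrow> X \<subseteq> S - {b} \<Longrightarrow> k \<le> cut_out M1 X"
    using sparse_out_cover[of "S - {b}" k E] fin by blast
  have "k \<le> cut_out E (- X)" if "X \<noteq> {}" "X \<subseteq> S - {a}" for X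
    using that ab \<open>S \<subseteq> V\<close> by (intro con) auto
  then obtain M2 where M2: "M2 \<subseteq># E" "size M2 \<le> k * card (S - {a})"
    "\<And>X. X \<noteq> {} \<Longrightarrow> X \<subseteq> S - {a} \<Longrightarrow> k \<le> cut_out M2 (- X)"
    using sparse_in_cover[of "S - {a}" k E] fin by blast
  have M12: "set_mset M1 \<subseteq> V \<times> V" "set_mset M2 \<subseteq> V \<times> V"
    using M1(1) M2(1) E by (meson order_trans set_mset_mono)+
  show thesis
  proof (rule that[of "M1 \<union># M2"])
    show "M1 \<union># M2 \<subseteq># E" using M1(1) M2(1) by simp
    have "size (M1 \<union># M2) \<le> size (M1 + M2)"
      by (intro size_mset_mono) (simp add: mset_subset_eqI)
    also have "\<dots> \<le> k * card S + k * card S"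
      using M1(2) M2(2) fin card_mono[of S "S - {b}"] card_mono[of S "S - {a}"]
      unfolding size_union by (meson Diff_subset add_mono le_trans mult_le_mono2)
    finally show "size (M1 \<union># M2) \<le> 2 * k * card S" by simp
    show "k \<le> cut_out (M1 \<union># M2) X" if "X \<inter> V \<noteq> {}" "X \<inter> V \<subseteq> S - {b}" for X
      using M1(3)[OF that] cut_out_restrict[OF M12(1), of X] cut_out_mono[of M1 "M1 \<union># M2" X]
      by simp
    show "k \<le> cut_out (M1 \<union># M2) X" if "\<not> V \<subseteq> X" "V - X \<subseteq> S - {a}" for X
    proof -
      have "- (V - X) \<inter> V = X \<inter> V" by auto
      then have "cut_out M2 (- (V - X)) = cut_out M2 X"
        using cut_out_restrict[OF M12(2), of X] cut_out_restrict[OF M12(2), of "- (V - X)"] by simp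
      then show ?thesis
        using M2(3)[of "V - X"] that cut_out_mono[of M2 "M1 \<union># M2" X] by auto
    qed
  qed
qed

lemma exists_maximum:
  fixes f :: "'a \<Rightarrow> nat"
  assumes "finite V" "V \<noteq> {}"
  obtains b where "b \<in> V" "\<And>u. u \<in> V \<Longrightarrow> f u \<le> f b"
proof -
  have "Max (f ` V) \<in> f ` V" using assms by (intro Max_in) auto
  then obtain b where "b \<in> V" "f b = Max (f ` V)" by auto
  then show thesis using assms(1) by (intro that[of b]) auto
qed

text \<open>Both sides count the pairs of a vertex \<open>v\<close> and a level
  \<open>j < k - t v\<close>.\<close>

lemma sum_card_levels:
  fixes t :: "'a \<Rightarrow> nat"
  assumes "finite W"
  shows "(\<Sum>j<k. card {v \<in> W. t v + j < k}) = (\<Sum>v\<in>W. k - t v)"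
proof -
  have "(\<Sum>j<k. card {v \<in> W. t v + j < k}) = (\<Sum>j<k. \<Sum>v\<in>W. if t v + j < k then 1 else 0)"
    using assms by (simp add: sum.If_cases Int_def)
  also have "\<dots> = (\<Sum>v\<in>W. \<Sum>j<k. if t v + j < k then 1 else 0)"
    by (rule sum.swap)
  also have "\<dots> = (\<Sum>v\<in>W. k - t v)"
  proof (intro sum.cong refl)
    fix v
    have "{..<k} \<inter> {j. t v + j < k} = {..<k - t v}" by auto
    then show "(\<Sum>j<k. if t v + j < k then 1 else 0) = k - t v"
      by (simp add: sum.If_cases)
  qed
  finally show ?thesis .
qed

lemma sparse_subgraph_large:
  fixes E :: "('a \<times> 'a) multiset"
  assumes k: "k \<ge> 1" and dense: "dense_digraph V (set_mset E) \<Delta>"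
    and con: "\<And>X. X \<inter> V \<noteq> {} \<Longrightarrow> \<not> V \<subseteq> X \<Longrightarrow> k \<le> cut_out E X"
    and big: "666 * k + 666 * \<Delta> \<le> card V"
  shows "\<exists>H. H \<subseteq># E \<and> size H \<le> k * card V + 490 * k * k + 98 * k * \<Delta> \<and>
    (\<forall>X. X \<inter> V \<noteq> {} \<longrightarrow> \<not> V \<subseteq> X \<longrightarrow> k \<le> cut_out H X)"
proof -
  interpret out: dense_digraph V "set_mset E" \<Delta> by (rule dense)
  interpret inn: dense_digraph V "(set_mset E)\<inverse>" \<Delta> by (rule out.dense_converse)
  have fV: "finite V" by (rule out.finite_V)
  have V: "V \<noteq> {}" using big k by auto
  obtain b where b: "b \<in> V" "\<And>u. u \<in> V \<Longrightarrow> card ((set_mset E)\<inverse> `` {u}) \<le> card ((set_mset E)\<inverse> `` {b})"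
    by (rule exists_maximum[OF fV V, of "\<lambda>u. card ((set_mset E)\<inverse> `` {u})"]) (rule that)
  obtain a where a: "a \<in> V" "\<And>u. u \<in> V \<Longrightarrow> card (set_mset E `` {u}) \<le> card (set_mset E `` {a})"
    by (rule exists_maximum[OF fV V, of "\<lambda>u. card (set_mset E `` {u})"]) (rule that)
  \<comment> \<open>The maximum out-degree is at least
    \<open>(card V - 1 - \<Delta>) / 2\<close>.\<close>
  have adeg: "18 * k + 3 * \<Delta> \<le> card (set_mset E `` {a})"
  proof -
    obtain u where u: "u \<in> V" "card V \<le> 2 * card (set_mset E `` {u} \<inter> V) + 1 + \<Delta>"
      using out.exists_large_outdegree[of V] V by auto
    have "card (set_mset E `` {u} \<inter> V) \<le> card (set_mset E `` {u})"
      by (intro card_mono) auto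
    then show ?thesis using u(2) a(2)[OF u(1)] big k by linarith
  qed
  have bdeg: "18 * k + 3 * \<Delta> \<le> card ((set_mset E)\<inverse> `` {b})"
  proof -
    obtain u where u: "u \<in> V" "card V \<le> 2 * card ((set_mset E)\<inverse> `` {u} \<inter> V) + 1 + \<Delta>"
      using out.exists_large_indegree[of V] V by auto
    have "card ((set_mset E)\<inverse> `` {u} \<inter> V) \<le> card ((set_mset E)\<inverse> `` {u})"
      by (intro card_mono) auto
    then show ?thesis using u(2) b(2)[OF u(1)] big k by linarith
  qed
  have ba: "k \<le> cut_out E X" if "b \<in> X" "a \<notin> X" for X
    using that a b by (intro con) auto
  obtain P where P: "P \<subseteq># E" "\<And>X. b \<in> X \<Longrightarrow> a \<notin> X \<Longrightarrow> k \<le> cut_out P X"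
    "\<And>v. odeg P v \<le> k" "\<And>v. ideg P v \<le> k"
    "\<And>v X. v \<in> X \<Longrightarrow> a \<notin> X \<Longrightarrow> odeg P v \<le> cut_out P X"
    "\<And>v X. v \<in> X \<Longrightarrow> b \<notin> X \<Longrightarrow> ideg P v \<le> cut_out P (- X)"
    "\<And>v. v \<noteq> a \<Longrightarrow> v \<noteq> b \<Longrightarrow> odeg P v = ideg P v"
    by (rule minimal_flow[of b a k E], rule ba, assumption+) (rule that)
  \<comment> \<open>\<open>\<tau>\<close> is the degree that \<open>out_connections\<close> demands;
    \<open>card S \<le> 4 * \<tau> + 2 * \<Delta> + 2\<close> then gives the constants 230 and
    46.\<close>
  define \<tau> where "\<tau> = 57 * k + 11 * \<Delta>"
  define S where "S = {v \<in> V. card (set_mset E `` {v}) < \<tau>} \<union>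
    {v \<in> V. card ((set_mset E)\<inverse> `` {v}) < \<tau>} \<union> {a, b}"
  have SV: "S \<subseteq> V" using a b by (auto simp: S_def)
  have "card S \<le> card {v \<in> V. card (set_mset E `` {v}) < \<tau>} +
      card {v \<in> V. card ((set_mset E)\<inverse> `` {v}) < \<tau>} + card {a, b}"
    unfolding S_def by (intro order_trans[OF card_Un_le] add_mono card_Un_le order_refl)
  also have "\<dots> \<le> (2 * \<tau> + \<Delta>) + (2 * \<tau> + \<Delta>) + 2"
    by (intro add_mono out.card_small_outdegree inn.card_small_outdegree) (simp add: card_insert_if)
  finally have cardS: "card S \<le> 230 * k + 46 * \<Delta>" using k by (simp add: \<tau>_def)
  have notS: "\<tau> \<le> card (set_mset E `` {v})" "\<tau> \<le> card ((set_mset E)\<inverse> `` {v})" "odeg P v = ideg P v"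
    if "v \<in> V - S" for v
    using that P(7)[of v] by (auto simp: S_def)
  obtain M where M: "M \<subseteq># E" "size M \<le> 2 * k * card S"
    "\<And>X. X \<inter> V \<noteq> {} \<Longrightarrow> X \<inter> V \<subseteq> S - {b} \<Longrightarrow> k \<le> cut_out M X"
    "\<And>X. \<not> V \<subseteq> X \<Longrightarrow> V - X \<subseteq> S - {a} \<Longrightarrow> k \<le> cut_out M X"
    by (rule boundary_cover[of E V k a b S], rule out.E_sub, rule fV, rule con, assumption+,
        rule a(1), rule b(1), rule SV) (rule that)
  have "\<exists>T Ss Es. (\<forall>j<k. T j \<subseteq> set_mset E - set_mset P \<and>
      path_system (T j) {v \<in> V - S. odeg P v + j < k} (\<Delta> + 2 * k + 1) (Ss j) (Es j)) \<and>
    (\<forall>i<k. \<forall>j<k. i \<noteq> j \<longrightarrow> T i \<inter> T j = {})"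
  proof (rule out.disjoint_path_systems)
    fix v assume "v \<in> V - S"
    then show "card (set_mset P `` {v}) \<le> odeg P v \<and> card ((set_mset P)\<inverse> `` {v}) \<le> odeg P v"
      using card_Image_le_odeg[of P v] card_Image_le_odeg[of "rev_edges P" v] notS(3)[of v]
      unfolding odeg_rev set_rev_edges by simp
  qed auto
  then obtain T Ss Es where T': "\<forall>j<k. T j \<subseteq> set_mset E - set_mset P \<and>
      path_system (T j) {v \<in> V - S. odeg P v + j < k} (\<Delta> + 2 * k + 1) (Ss j) (Es j)"
    "\<forall>i<k. \<forall>j<k. i \<noteq> j \<longrightarrow> T i \<inter> T j = {}"
    by (elim exE conjE that)
  then have T: "\<And>j. j < k \<Longrightarrow> T j \<subseteq> set_mset E - set_mset P"
    "\<And>j. j < k \<Longrightarrow> path_system (T j) {v \<in> V - S. odeg P v + j < k} (\<Delta> + 2 * k + 1) (Ss j) (Es j)"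
    "\<And>i j. i < k \<Longrightarrow> j < k \<Longrightarrow> i \<noteq> j \<Longrightarrow> T i \<inter> T j = {}" by blast+
  define TT where "TT = (\<Union>j<k. T j)"
  define q where "q = 3 * k * (\<Delta> + 2 * k + 1) + 3 * k * (k + 1)"
  have small: "37 * k + 7 * \<Delta> \<le> card V" using big by simp
  have "\<exists>Q\<subseteq>set_mset E. card Q \<le> q \<and> (\<forall>H X. P \<subseteq># H \<longrightarrow> Q \<union> (\<Union>j<k. T j) \<subseteq> set_mset H \<longrightarrow>
      b \<notin> X \<longrightarrow> (X \<inter> (V - S) \<noteq> {} \<or> a \<in> X) \<longrightarrow> k \<le> cut_out H X)"
    unfolding q_def
  proof (rule out.out_connections[OF k a(1) b(1,2) adeg small _ P(3,4) notS(3) P(5) T])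
    show "57 * k + 11 * \<Delta> \<le> card (set_mset E `` {v})" if "v \<in> V - S" for v
      using notS(1)[OF that] by (simp add: \<tau>_def)
  qed
  then obtain Q1 where Q1: "Q1 \<subseteq> set_mset E" "card Q1 \<le> q"
    "\<forall>H X. P \<subseteq># H \<longrightarrow> Q1 \<union> (\<Union>j<k. T j) \<subseteq> set_mset H \<longrightarrow>
      b \<notin> X \<longrightarrow> (X \<inter> (V - S) \<noteq> {} \<or> a \<in> X) \<longrightarrow> k \<le> cut_out H X"
    by (elim exE conjE that)
  \<comment> \<open>Reversal exchanges \<open>a\<close> with \<open>b\<close> and the starts of
    paths with their ends. The same path systems serve both directions and are paid for only
    once.\<close>
  have "\<exists>Q\<subseteq>(set_mset E)\<inverse>. card Q \<le> q \<and>
      (\<forall>H X. rev_edges P \<subseteq># H \<longrightarrow> Q \<union> (\<Union>j<k. (T j)\<inverse>) \<subseteq> set_mset H \<longrightarrow>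
      a \<notin> X \<longrightarrow> (X \<inter> (V - S) \<noteq> {} \<or> b \<in> X) \<longrightarrow> k \<le> cut_out H X)"
    unfolding q_def
  proof (rule inn.out_connections[OF k b(1) a(1) _ bdeg small])
    show "card (((set_mset E)\<inverse>)\<inverse> `` {u}) \<le> card (((set_mset E)\<inverse>)\<inverse> `` {a})" if "u \<in> V" for u
      using a(2)[OF that] by simp
    show "57 * k + 11 * \<Delta> \<le> card ((set_mset E)\<inverse> `` {v})" if "v \<in> V - S" for v
      using notS(2)[OF that] by (simp add: \<tau>_def)
    show "odeg (rev_edges P) v \<le> k" "ideg (rev_edges P) v \<le> k" for v
      using P(3,4) by (simp_all only: odeg_rev ideg_rev)
    show "odeg (rev_edges P) v = ideg (rev_edges P) v" if "v \<in> V - S" for v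
      using notS(3)[OF that] by (simp only: odeg_rev ideg_rev)
    show "odeg (rev_edges P) v \<le> cut_out (rev_edges P) X" if "v \<in> X" "b \<notin> X" for v X
      using P(6)[OF that] by (simp only: odeg_rev cut_out_rev)
    show "(T j)\<inverse> \<subseteq> (set_mset E)\<inverse> - set_mset (rev_edges P)" if "j < k" for j
      using T(1)[OF that] unfolding set_rev_edges by auto
    show "path_system ((T j)\<inverse>) {v \<in> V - S. odeg (rev_edges P) v + j < k} (\<Delta> + 2 * k + 1) (Es j) (Ss j)"
      if "j < k" for j
    proof -
      have "{v \<in> V - S. odeg (rev_edges P) v + j < k} = {v \<in> V - S. odeg P v + j < k}"
        using notS(3) unfolding odeg_rev by auto
      then show ?thesis using path_system_converse[OF T(2)[OF that]] by simp
    qed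
    show "(T i)\<inverse> \<inter> (T j)\<inverse> = {}" if "i < k" "j < k" "i \<noteq> j" for i j
      using T(3)[OF that] by auto
  qed
  then obtain Q2 where Q2: "Q2 \<subseteq> (set_mset E)\<inverse>" "card Q2 \<le> q"
    "\<forall>H X. rev_edges P \<subseteq># H \<longrightarrow> Q2 \<union> (\<Union>j<k. (T j)\<inverse>) \<subseteq> set_mset H \<longrightarrow>
      a \<notin> X \<longrightarrow> (X \<inter> (V - S) \<noteq> {} \<or> b \<in> X) \<longrightarrow> k \<le> cut_out H X"
    by (elim exE conjE that)
  define Z where "Z = TT \<union> Q1 \<union> Q2\<inverse>"
  have ZE: "Z \<subseteq> set_mset E" using T(1) Q1(1) Q2(1) by (auto simp: Z_def TT_def)
  then have finZ: "finite Z" by (meson finite_set_mset finite_subset)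
  \<comment> \<open>The union takes maxima of multiplicities, which keeps \<open>H\<close> inside
    \<open>E\<close>.\<close>
  define H where "H = (P \<union># M) \<union># mset_set Z"
  have "mset_set Z \<subseteq># E"
    using subset_imp_msubset_mset_set[OF ZE] mset_set_set_mset_msubset[of E]
    by (meson finite_set_mset subset_mset.order_trans)
  then have HE: "H \<subseteq># E" using P(1) M(1) by (simp add: H_def)
  have HP: "P \<subseteq># H" and HM: "M \<subseteq># H" and HZ: "Z \<subseteq> set_mset H"
    unfolding H_def using finZ
    by (auto intro: subset_mset.le_supI1 simp: set_mset_sup)
  have sizeH: "size H \<le> size P + size M + card Z"
  proof -
    have "H \<subseteq># P + M + mset_set Z" unfolding H_def by (simp add: mset_subset_eqI)
    from size_mset_mono[OF this] show ?thesis by simp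
  qed
  have sizeP: "size P = (\<Sum>v\<in>V. odeg P v)"
  proof (rule size_eq_sum_odeg[OF fV])
    show "fst ` set_mset P \<subseteq> V" using set_mset_mono[OF P(1)] out.E_sub by auto
  qed
  \<comment> \<open>Each vertex \<open>v\<close> is charged \<open>odeg P v\<close> for the flow and
    at most \<open>k - odeg P v\<close> for the paths, hence at most \<open>k\<close> in
    total.\<close>
  have "card TT \<le> (\<Sum>j<k. card (T j))" unfolding TT_def by (rule card_UN_le) simp
  also have "\<dots> \<le> (\<Sum>j<k. card {v \<in> V - S. odeg P v + j < k})"
    using T(2) fV by (intro sum_mono path_system_card) auto
  also have "\<dots> = (\<Sum>v\<in>V - S. k - odeg P v)"
    using fV by (intro sum_card_levels) simp
  also have "\<dots> \<le> (\<Sum>v\<in>V. k - odeg P v)"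
    using fV by (intro sum_mono2) auto
  finally have "size P + card TT \<le> (\<Sum>v\<in>V. odeg P v + (k - odeg P v))"
    unfolding sizeP sum.distrib by simp
  also have "\<dots> = k * card V" using P(3) by simp
  finally have PT: "size P + card TT \<le> k * card V" .
  have "card Z \<le> card TT + card Q1 + card Q2"
    using card_Un_le[of "TT \<union> Q1" "Q2\<inverse>"] card_Un_le[of TT Q1] unfolding Z_def card_inverse by linarith
  then have "size H \<le> k * card V + 2 * k * card S + 2 * q"
    using sizeH PT M(2) Q1(2) Q2(2) by linarith
  also have "\<dots> \<le> k * card V + 2 * k * (230 * k + 46 * \<Delta>) + 2 * q"
    using cardS by simp
  \<comment> \<open>\<open>M\<close> contributes \<open>460 * k * k + 92 * k * \<Delta>\<close>, and
    \<open>2 * q\<close> is \<open>18 * k * k + 6 * k * \<Delta> + 12 * k\<close>, whose linear term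
    is bounded by \<open>12 * k * k\<close>.\<close>
  also have "\<dots> \<le> k * card V + 490 * k * k + 98 * k * \<Delta>"
  proof -
    have "k \<le> k * k" using k by simp
    then show ?thesis by (simp add: q_def algebra_simps)
  qed
  finally have size: "size H \<le> k * card V + 490 * k * k + 98 * k * \<Delta>" .
  have "k \<le> cut_out H X" if X: "X \<inter> V \<noteq> {}" "\<not> V \<subseteq> X" for X
  proof -
    \<comment> \<open>Sets avoiding \<open>b\<close> use \<open>Q1\<close>, or \<open>M\<close> if
      they lie within \<open>S\<close>; sets containing \<open>a\<close> use \<open>Q2\<close> in
      the reversed graph, or \<open>M\<close> if they miss only vertices of \<open>S\<close>; the
      flow \<open>P\<close> covers the rest.\<close>
    consider "b \<notin> X" "X \<inter> (V - S) \<noteq> {} \<or> a \<in> X" | "b \<notin> X" "X \<inter> (V - S) = {}"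
      | "a \<in> X" "- X \<inter> (V - S) \<noteq> {}" | "a \<in> X" "- X \<inter> (V - S) = {}" | "b \<in> X" "a \<notin> X"
      by blast
    then show ?thesis
    proof cases
      case 1
      have "Q1 \<union> (\<Union>j<k. T j) \<subseteq> set_mset H" using HZ by (auto simp: Z_def TT_def)
      with 1 HP Q1(3) show ?thesis by blast
    next
      case 2
      then have "k \<le> cut_out M X" using X by (intro M(3)) auto
      then show ?thesis using cut_out_mono[OF HM, of X] by simp
    next
      case 3
      have "rev_edges P \<subseteq># rev_edges H" using HP by (rule image_mset_subseteq_mono)
      moreover have "Q2 \<union> (\<Union>j<k. (T j)\<inverse>) \<subseteq> Z\<inverse>"
        unfolding Z_def TT_def by (auto 0 3)
      then have "Q2 \<union> (\<Union>j<k. (T j)\<inverse>) \<subseteq> set_mset (rev_edges H)"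
        using HZ unfolding set_rev_edges by (meson converse_mono order_trans)
      moreover have "a \<notin> - X" using 3(1) by simp
      ultimately have "k \<le> cut_out (rev_edges H) (- X)"
        using 3(2) Q2(3)[rule_format, of "rev_edges H" "- X"] by simp
      then show ?thesis by (simp only: cut_out_rev double_complement)
    next
      case 4
      then have "k \<le> cut_out M X" using X by (intro M(4)) auto
      then show ?thesis using cut_out_mono[OF HM, of X] by simp
    next
      case 5
      then show ?thesis using P(2)[of X] cut_out_mono[OF HP, of X] by simp
    qed
  qed
  with HE size show ?thesis by blast
qed

theorem theorem6p2:
  fixes k n \<Delta> :: nat and D :: "'a multidigraph"
  assumes "k \<ge> 1" and "n \<ge> 1"
    and "directed_multigraph D"
    and "card (verts D) = n"
    and "strongly_arc_connected k D"
    and "max_non_neighbours D \<le> \<Delta>"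
  shows "\<exists>H. spanning_subgraph H D \<and> strongly_arc_connected k H \<and>
           size (edges H) \<le> k * n + 666 * k * \<Delta> + 666 * k ^ 2"
proof -
  define V where "V = verts D"
  define E where "E = edges D"
  have fV: "finite V" and EV: "set_mset E \<subseteq> V \<times> V" and loopless: "\<And>v. (v, v) \<notin># E"
    using assms(3) unfolding directed_multigraph_def V_def E_def by auto
  have con: "k \<le> cut_out E X" if "X \<inter> V \<noteq> {}" "\<not> V \<subseteq> X" for X
    using assms(5) that unfolding strongly_arc_connected_iff V_def E_def by blast
  have "\<exists>H. H \<subseteq># E \<and> size H \<le> k * n + 666 * k * \<Delta> + 666 * k ^ 2 \<and>
    (\<forall>X. X \<inter> V \<noteq> {} \<longrightarrow> \<not> V \<subseteq> X \<longrightarrow> k \<le> cut_out H X)"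
  proof (cases "666 * k + 666 * \<Delta> \<le> n")
    case True
    have "dense_digraph V (set_mset E) \<Delta>"
    proof
      fix v assume v: "v \<in> V"
      have "card {w \<in> V. w \<noteq> v \<and> (v, w) \<notin># E \<and> (w, v) \<notin># E} \<le> max_non_neighbours D"
        unfolding max_non_neighbours_def using v fV by (intro Max_ge) (auto simp: V_def E_def)
      then show "card {w \<in> V. w \<noteq> v \<and> (v, w) \<notin># E \<and> (w, v) \<notin># E} \<le> \<Delta>"
        using assms(6) by simp
    qed (use fV EV loopless in auto)
    then obtain H where H: "H \<subseteq># E" "size H \<le> k * card V + 490 * k * k + 98 * k * \<Delta>"
      "\<forall>X. X \<inter> V \<noteq> {} \<longrightarrow> \<not> V \<subseteq> X \<longrightarrow> k \<le> cut_out H X"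
      using sparse_subgraph_large[OF assms(1) _ con] True assms(4) by (metis V_def)
    have "size H \<le> k * n + 666 * k * \<Delta> + 666 * k ^ 2"
      using H(2) assms(4) by (simp add: V_def power2_eq_square)
    with H show ?thesis by blast
  next
    case False
    have "V \<noteq> {}" using assms(2,4) by (auto simp: V_def)
    then obtain r where "r \<in> V" by blast
    \<comment> \<open>Every set contains \<open>r\<close> or avoids it, so taking \<open>r\<close>
      for both \<open>a\<close> and \<open>b\<close>, and \<open>V\<close> for \<open>S\<close>,
      covers all cuts.\<close>
    obtain M where M: "M \<subseteq># E" "size M \<le> 2 * k * card V"
      "\<And>X. X \<inter> V \<noteq> {} \<Longrightarrow> X \<inter> V \<subseteq> V - {r} \<Longrightarrow> k \<le> cut_out M X"
      "\<And>X. \<not> V \<subseteq> X \<Longrightarrow> V - X \<subseteq> V - {r} \<Longrightarrow> k \<le> cut_out M X"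
      by (rule boundary_cover[of E V k r r V], rule EV, rule fV, rule con, assumption+,
          rule \<open>r \<in> V\<close>, rule \<open>r \<in> V\<close>, rule order_refl) (rule that)
    \<comment> \<open>One half of \<open>2 * k * n\<close> is kept; the other is bounded because
      \<open>n\<close> is below the threshold.\<close>
    have "k * n \<le> k * (666 * k + 666 * \<Delta>)" using False by (intro mult_le_mono2) simp
    then have "size M \<le> k * n + 666 * k * \<Delta> + 666 * k ^ 2"
      using M(2) assms(4) by (simp add: V_def power2_eq_square algebra_simps)
    moreover have "k \<le> cut_out M X" if "X \<inter> V \<noteq> {}" "\<not> V \<subseteq> X" for X
      using M(3)[of X] M(4)[of X] that by (cases "r \<in> X") auto
    ultimately show ?thesis using M(1) by blast
  qed
  then obtain H where H: "H \<subseteq># E" "size H \<le> k * n + 666 * k * \<Delta> + 666 * k ^ 2"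
    "\<forall>X. X \<inter> V \<noteq> {} \<longrightarrow> \<not> V \<subseteq> X \<longrightarrow> k \<le> cut_out H X"
    by blast
  have "spanning_subgraph (V, H) D"
    using assms(3) set_mset_mono[OF H(1)] H(1)
    unfolding spanning_subgraph_def directed_multigraph_def V_def E_def by auto
  moreover have "strongly_arc_connected k (V, H)"
    using H(3) unfolding strongly_arc_connected_iff by simp
  ultimately show ?thesis using H(2) by (intro exI[of _ "(V, H)"]) simp
qed

end
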